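(* Let $B=\{x\in\mathbb{R}^3:|x|<R\}$ be a ball with boundary $S$. For $\kappa=(n,m,k)$ with $n\ge0$, $m\in\mathbb{N}$, $|k|\le n$, and real constants $c_\kappa\ne0$, let $$g_\kappa(r,\theta,\varphi)=c_\kappa\,\psi_n(\alpha_{n,m}r/R)\,Y_n^k(\theta,\varphi).$$ Then the vector-functions $\mathbf{q}_\kappa=\nabla g_\kappa$ are solutions in $\mathbf{L}_2(B)$ of the spectral problem $$-\nabla\,\mathrm{div}\,\mathbf{q}=\mu\,\mathbf{q}\ \text{ in } B,\qquad \mathbf{n}\cdot\mathbf{q}|_{S}=0$$ with $\mu=\alpha_{n,m}^2R^{-2}$. Their components $(q_r,q_\theta,q_\varphi)$ in spherical coordinates are $$q_{r,\kappa}(r,\theta,\varphi)=c_\kappa\frac{\alpha_{n,m}}{R}\,\psi_n'(\alpha_{n,m}r/R)\,Y_n^k(\theta,\varphi),$$ $$(q_\varphi+iq_\theta)_\kappa=c_\kappa\frac1r\,\psi_n(\alpha_{n,m}r/R)\,\mathrm{H}Y_n^k(\theta,\varphi).$$ Moreover, $\mathbf{q}_\kappa$ and $\mathbf{q}_{\kappa'}$ are orthogonal in $\mathbf{L}_2(B)$ for $\kappa'\neq\kappa$, and $\|\mathbf{q}_\kappa\|=(\alpha_{n,m}/R)\,\|g_\kappa\|$ (norms in $\mathbf{L}_2(B)$ and $L_2(B)$ respectively).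
   Context: $\psi_n(z)=(-z)^n\big(\frac{d}{z\,dz}\big)^n\frac{\sin z}{z}$ for $n\ge0$; $\alpha_{n,m}>0$ ($m\in\mathbb{N}$) are the positive zeros of the derivative $\psi_n'$. $(r,\theta,\varphi)$ are spherical coordinates ($\theta$ the polar angle, $\varphi$ the azimuth), and $Y_n^k(\theta,\varphi)$, $|k|\le n$, are the real spherical harmonics (mutually orthogonal on the unit sphere). $\mathrm{H}$ is the first-order operator $\mathrm{H}Y=\frac{1}{\sin\theta}\partial_\varphi Y+i\,\partial_\theta Y$. $\mathbf{n}$ is the outer normal to $S$. *)

theory Defs
  imports "HOL-Analysis.Analysis" "HOL-Computational_Algebra.Polynomial"
begin

section \<open>The functions \<open>\<psi>\<^sub>n\<close> and the zeros of their derivatives\<close>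

definition psi_formula :: "nat \<Rightarrow> real \<Rightarrow> real" where
  "psi_formula n z = (- z) ^ n * (((\<lambda>f w. deriv f w / w) ^^ n) (\<lambda>w. sin w / w)) z"

text \<open>The formula has a removable singularity at the origin, where it is extended by continuity.\<close>

definition psi :: "nat \<Rightarrow> real \<Rightarrow> real" where
  "psi n z = (if z = 0 then Lim (at 0) (psi_formula n) else psi_formula n z)"

text \<open>For \<open>m \<ge> 1\<close>, \<open>alpha n m\<close> is the \<open>m\<close>-th positive zero of \<open>\<psi>\<^sub>n'\<close> in increasing order;
  \<open>alpha n 0 = 0\<close> only starts the recursion.\<close>

fun alpha :: "nat \<Rightarrow> nat \<Rightarrow> real" where
  "alpha n 0 = 0"
| "alpha n (Suc m) = Inf {z. alpha n m < z \<and> deriv (psi n) z = 0}"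

section \<open>Real spherical harmonics\<close>

definition legendre_poly :: "nat \<Rightarrow> real poly" where
  "legendre_poly n = smult (1 / (2 ^ n * fact n)) ((pderiv ^^ n) ([:-1, 0, 1:] ^ n))"

definition assoc_legendre :: "nat \<Rightarrow> nat \<Rightarrow> real \<Rightarrow> real" where
  "assoc_legendre n k x = sqrt (1 - x\<^sup>2) ^ k * poly ((pderiv ^^ k) (legendre_poly n)) x"

text \<open>The harmonics are not normalised and carry no Condon--Shortley sign: such nonzero factors
  are absorbed by the arbitrary constants \<open>c\<^sub>\<kappa>\<close> below.\<close>

definition sph_harm :: "nat \<Rightarrow> int \<Rightarrow> real \<Rightarrow> real \<Rightarrow> real" where
  "sph_harm n k \<theta> \<phi> = assoc_legendre n (nat \<bar>k\<bar>) (cos \<theta>) *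
     (if k \<ge> 0 then cos (of_int k * \<phi>) else sin (of_int \<bar>k\<bar> * \<phi>))"

definition H_op :: "(real \<Rightarrow> real \<Rightarrow> real) \<Rightarrow> real \<Rightarrow> real \<Rightarrow> complex" where
  "H_op Y \<theta> \<phi> = complex_of_real (1 / sin \<theta> * deriv (\<lambda>p. Y \<theta> p) \<phi>)
     + \<i> * complex_of_real (deriv (\<lambda>t. Y t \<phi>) \<theta>)"

section \<open>Spherical coordinates\<close>

definition e_r :: "real \<Rightarrow> real \<Rightarrow> real ^ 3" where
  "e_r \<theta> \<phi> = vector [sin \<theta> * cos \<phi>, sin \<theta> * sin \<phi>, cos \<theta>]"

definition e_theta :: "real \<Rightarrow> real \<Rightarrow> real ^ 3" where
  "e_theta \<theta> \<phi> = vector [cos \<theta> * cos \<phi>, cos \<theta> * sin \<phi>, - sin \<theta>]"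

definition e_phi :: "real \<Rightarrow> real \<Rightarrow> real ^ 3" where
  "e_phi \<theta> \<phi> = vector [- sin \<phi>, cos \<phi>, 0]"

definition polar_angle :: "real ^ 3 \<Rightarrow> real" where
  "polar_angle x = arccos (x $ 3 / norm x)"

definition azimuth :: "real ^ 3 \<Rightarrow> real" where
  "azimuth x = Arg (Complex (x $ 1) (x $ 2))"

section \<open>Vector calculus and square-integrable fields\<close>

definition grad :: "('a::real_inner \<Rightarrow> real) \<Rightarrow> 'a \<Rightarrow> 'a" where
  "grad f x = (THE D. GDERIV f x :> D)"

definition divergence :: "('a::euclidean_space \<Rightarrow> 'a) \<Rightarrow> 'a \<Rightarrow> real" where
  "divergence F x = (\<Sum>b\<in>Basis. frechet_derivative F (at x) b \<bullet> b)"

definition L2 :: "'a::euclidean_space set \<Rightarrow> ('a \<Rightarrow> 'b::euclidean_space) set" where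
  "L2 B = {f. f \<in> borel_measurable (lebesgue_on B) \<and>
              integrable (lebesgue_on B) (\<lambda>x. (norm (f x))\<^sup>2)}"

definition L2_inner ::
  "'a::euclidean_space set \<Rightarrow> ('a \<Rightarrow> 'b::euclidean_space) \<Rightarrow> ('a \<Rightarrow> 'b) \<Rightarrow> real" where
  "L2_inner B f h = (LINT x|lebesgue_on B. f x \<bullet> h x)"

definition L2_norm :: "'a::euclidean_space set \<Rightarrow> ('a \<Rightarrow> 'b::euclidean_space) \<Rightarrow> real" where
  "L2_norm B f = sqrt (L2_inner B f f)"

text \<open>A nontrivial classical solution, continuous up to the boundary, of
  \<open>- \<nabla> div q = \<mu> q\<close> in the ball of radius \<open>R\<close>, \<open>n \<cdot> q = 0\<close> on its boundary. The outer normal at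
  \<open>x\<close> is \<open>x / R\<close>. The differentiability clauses exclude the arbitrary values of \<open>grad\<close> and
  \<open>divergence\<close> where no derivative exists.\<close>

definition solves_grad_div_problem ::
  "real \<Rightarrow> real \<Rightarrow> (real ^ 3 \<Rightarrow> real ^ 3) \<Rightarrow> bool" where
  "solves_grad_div_problem R \<mu> q \<longleftrightarrow>
     q \<in> L2 (ball 0 R) \<and>
     (\<exists>x\<in>ball 0 R. q x \<noteq> 0) \<and>
     (\<forall>x\<in>ball 0 R. q differentiable (at x) \<and> divergence q differentiable (at x) \<and>
        - grad (divergence q) x = \<mu> *\<^sub>R q x) \<and>
     continuous_on (cball 0 R) q \<and>
     (\<forall>x\<in>sphere 0 R. (x /\<^sub>R R) \<bullet> q x = 0)"

section \<open>The functions \<open>g\<^sub>\<kappa>\<close> and their gradients\<close>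

definition kappas :: "(nat \<times> nat \<times> int) set" where
  "kappas = {(n, m, k). m \<ge> 1 \<and> \<bar>k\<bar> \<le> int n}"

text \<open>On the polar axis and at the origin, where the angles are not determined by the point,
  the values chosen by \<open>arccos\<close>, \<open>Arg\<close> and division by zero give the continuous extension: the
  harmonics with \<open>k \<noteq> 0\<close> vanish at the poles, and \<open>\<psi>\<^sub>n 0 = 0\<close> for \<open>n \<ge> 1\<close>.\<close>

fun g_fun :: "real \<Rightarrow> (nat \<times> nat \<times> int \<Rightarrow> real) \<Rightarrow> nat \<times> nat \<times> int \<Rightarrow> real ^ 3 \<Rightarrow> real" where
  "g_fun R c (n, m, k) x = c (n, m, k) * psi n (alpha n m * norm x / R) *
     sph_harm n k (polar_angle x) (azimuth x)"

definition q_field ::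
  "real \<Rightarrow> (nat \<times> nat \<times> int \<Rightarrow> real) \<Rightarrow> nat \<times> nat \<times> int \<Rightarrow> real ^ 3 \<Rightarrow> real ^ 3" where
  "q_field R c \<kappa> = grad (g_fun R c \<kappa>)"

end

theory Submission
  imports Defs "HOL-Complex_Analysis.Conformal_Mappings"
begin

text \<open>In Cartesian coordinates the functions \<open>g\<^sub>\<kappa>\<close> are smooth on all of space. With
  \<open>s(t) = sin (sqrt t) / sqrt t\<close>, an entire function of \<open>t\<close>, the chain rule gives
  \<open>\<psi>\<^sub>n(z) = (- 2 z)\<^sup>n s\<^sup>(\<^sup>n\<^sup>)(z\<^sup>2)\<close> (\<open>psi_eq\<close>), and \<open>r\<^sup>n Y\<^sub>n\<^sup>k\<close> is a homogeneous harmonic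
  polynomial \<open>P\<close> of degree \<open>n\<close> (\<open>solid_harmonic_spherical\<close>, \<open>solid_harmonic_laplace\<close>). Hence, up to a
  constant, \<open>g\<^sub>\<kappa>(x) = s\<^sup>(\<^sup>n\<^sup>)(b\<^sup>2 |x|\<^sup>2) P(x)\<close> with \<open>b = \<alpha>\<^sub>n\<^sub>,\<^sub>m / R\<close>, and the differential equation of
  \<open>s\<^sup>(\<^sup>n\<^sup>)\<close> together with Euler's identity for \<open>P\<close> yields \<open>\<Delta> g\<^sub>\<kappa> = - b\<^sup>2 g\<^sub>\<kappa>\<close> everywhere, poles and origin
  included (\<open>mode_helmholtz\<close>). Taking the gradient of this equation gives
  \<open>- \<nabla> div q\<^sub>\<kappa> = b\<^sup>2 q\<^sub>\<kappa>\<close>, and \<open>\<psi>\<^sub>n'(\<alpha>\<^sub>n\<^sub>,\<^sub>m) = 0\<close> is the boundary condition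
  (\<open>mode_neumann\<close>). The spherical components are derivatives of \<open>g\<^sub>\<kappa>\<close> along the coordinate curves
  (\<open>mode_gradient_components\<close>).

  That \<open>\<alpha>\<^sub>n\<^sub>,\<^sub>m\<close>, an infimum, really is a zero and increases strictly with \<open>m\<close> needs two things: zeros
  of \<open>\<psi>\<^sub>n'\<close> beyond every bound, which come from those of the sine by repeated use of Rolle's theorem,
  and isolated zeros, which come from the analytic extension of \<open>\<psi>\<^sub>n'\<close> to the complex plane.

  All integral identities come from one fact: the divergence of a field tangent to the sphere
  integrates to zero over the ball (\<open>divergence_theorem_tangential\<close>). Applied to \<open>g \<nabla>h\<close> it gives
  \<open>\<integral> \<nabla>g \<cdot> \<nabla>h = l \<integral> g h\<close>, where \<open>l\<close> is the eigenvalue of \<open>h\<close> (\<open>green_tangential\<close>). With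
  \<open>g = h\<close> this is the norm identity; it also reduces orthogonality of the gradients to orthogonality
  of the \<open>g\<^sub>\<kappa>\<close>, and settles the case of distinct eigenvalues, hence that of equal \<open>(n, k)\<close> and distinct
  \<open>m\<close>. For distinct \<open>n\<close> the fields \<open>w(|x|\<^sup>2) (P \<nabla>Q - Q \<nabla>P)\<close>, and for distinct \<open>k\<close> the fields
  \<open>f(|x|\<^sup>2) P Q\<close> times the generator of rotations about the polar axis, show that
  \<open>f(|x|\<^sup>2) P Q\<close> integrates to zero; this stands in for the orthogonality of spherical harmonics.\<close>

section \<open>The divergence theorem on a ball for tangential fields\<close>

lemma C1_lipschitz_on_cball:
  fixes F :: "'a::euclidean_space \<Rightarrow> 'b::real_normed_vector"
  assumes der: "\<And>x. (F has_derivative D x) (at x)"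
    and cont: "\<And>h. continuous_on UNIV (\<lambda>x. D x h)"
  obtains L where "L > 0"
    "\<And>x y. x \<in> cball 0 R \<Longrightarrow> y \<in> cball 0 R \<Longrightarrow> norm (F x - F y) \<le> L * norm (x - y)"
proof -
  have "compact ((\<lambda>x. \<Sum>b\<in>Basis. norm (D x b)) ` cball 0 R)"
    by (intro compact_continuous_image continuous_intros continuous_on_subset[OF cont]) auto
  then obtain L where L: "L > 0" "\<And>x. x \<in> cball 0 R \<Longrightarrow> \<bar>\<Sum>b\<in>Basis. norm (D x b)\<bar> \<le> L"
    by (auto simp: bounded_pos dest!: compact_imp_bounded)
  have on: "onorm (D x) \<le> L" if "x \<in> cball 0 R" for x
  proof (rule onorm_le)
    fix h :: 'a
    have lin: "linear (D x)" using der has_derivative_linear by blast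
    have "D x h = D x (\<Sum>b\<in>Basis. (h \<bullet> b) *\<^sub>R b)" by (simp add: euclidean_representation)
    also have "\<dots> = (\<Sum>b\<in>Basis. (h \<bullet> b) *\<^sub>R D x b)"
      using lin by (simp add: linear_sum linear_scale)
    also have "norm \<dots> \<le> (\<Sum>b\<in>Basis. norm h * norm (D x b))"
      by (intro sum_norm_le) (auto intro!: mult_right_mono Basis_le_norm)
    also have "\<dots> = norm h * (\<Sum>b\<in>Basis. norm (D x b))" by (simp add: sum_distrib_left)
    also have "\<dots> \<le> norm h * L" using L(2)[OF that] by (intro mult_left_mono) auto
    finally show "norm (D x h) \<le> L * norm h" by (simp add: mult.commute)
  qed
  show thesis
  proof (rule that[OF L(1)])
    fix x y :: 'a assume "x \<in> cball 0 R" "y \<in> cball 0 R"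
    then show "norm (F x - F y) \<le> L * norm (x - y)"
      by (intro differentiable_bound[of "cball 0 R" F D]) (auto intro: on der has_derivative_at_withinI)
  qed
qed

lemma lborel_integral_translate:
  fixes f :: "'a::euclidean_space \<Rightarrow> real"
  assumes [measurable]: "f \<in> borel_measurable borel"
  shows "(LINT x|lborel. f (x + c)) = (LINT x|lborel. f x)"
proof -
  have "(LINT x|lborel. f x) = (LINT x|distr lborel borel ((+) c). f x)"
    by (simp add: lborel_distr_plus)
  also have "\<dots> = (LINT x|lborel. f (x + c))"
    by (subst integral_distr) (auto simp: add.commute)
  finally show ?thesis by simp
qed

text \<open>Since \<open>u\<close> vanishes on the sphere, its extension by zero from the ball is Lipschitz. The integral
  of every difference quotient of that extension is zero by translation invariance, and the quotients
  converge boundedly to the derivative off the sphere, a null set.\<close>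

lemma integral_derivative_over_ball:
  fixes u :: "'a::euclidean_space \<Rightarrow> real"
  assumes R: "R > 0"
    and der: "\<And>x. (u has_derivative D x) (at x)"
    and cont: "\<And>h. continuous_on UNIV (\<lambda>x. D x h)"
    and zero: "\<And>x. norm x = R \<Longrightarrow> u x = 0"
  shows "(LINT x|lborel. indicator (ball 0 R) x * D x h) = 0"
proof -
  obtain L where L: "L > 0"
    "\<And>x y. x \<in> cball 0 R \<Longrightarrow> y \<in> cball 0 R \<Longrightarrow> norm (u x - u y) \<le> L * norm (x - y)"
    using C1_lipschitz_on_cball[of u D R] der cont by blast
  define cp where "cp = closest_point (cball (0::'a) R)"
  \<comment> \<open>The nearest-point projection does not increase distances and sends the exterior to the sphere, where \<open>u = 0\<close>.\<close>
  define v where "v = u \<circ> cp"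
  have cp_in: "cp x \<in> cball 0 R" for x
    unfolding cp_def using R by (intro closest_point_in_set) auto
  have lip: "\<bar>v x - v y\<bar> \<le> L * norm (x - y)" for x y
  proof -
    have "\<bar>v x - v y\<bar> \<le> L * norm (cp x - cp y)"
      using L(2)[OF cp_in cp_in] by (simp add: v_def)
    also have "dist (cp x) (cp y) \<le> dist x y"
      unfolding cp_def using R by (intro closest_point_lipschitz) auto
    then have "L * norm (cp x - cp y) \<le> L * norm (x - y)"
      using L(1) by (simp add: dist_norm)
    finally show ?thesis .
  qed
  have v_in: "v x = u x" if "norm x \<le> R" for x
    using that by (simp add: v_def cp_def closest_point_self)
  have v_out: "v x = 0" if "norm x \<ge> R" for x
  proof (cases "norm x = R")
    case True then show ?thesis using v_in zero by simp
  next
    case False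
    then have "cp x \<in> rel_frontier (cball 0 R)"
      unfolding cp_def using that R
      by (intro closest_point_in_rel_frontier) (auto simp: affine_hull_nonempty_interior rel_interior_nonempty_interior)
    then have "norm (cp x) = R"
      using R by (simp add: rel_frontier_cball)
    then show ?thesis by (simp add: v_def zero)
  qed
  have v_cont: "continuous_on UNIV v"
  proof -
    have "L-lipschitz_on UNIV v"
      using L lip by (intro lipschitz_onI) (auto simp: dist_norm)
    then show ?thesis by (rule lipschitz_on_continuous_on)
  qed
  then have v_meas [measurable]: "v \<in> borel_measurable borel"
    by (rule borel_measurable_continuous_onI)
  have Dm [measurable]: "(\<lambda>x. D x h) \<in> borel_measurable borel"
    by (intro borel_measurable_continuous_onI cont)
  define e where "e = (\<lambda>i::nat. 1 / real (Suc i))"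
  have e: "e i > 0" "e i \<le> 1" for i by (auto simp: e_def divide_simps)
  then have ne: "e i \<noteq> 0" for i by (simp add: less_imp_neq[symmetric])
  have e0: "e \<longlonglongrightarrow> 0" unfolding e_def by (rule LIMSEQ_Suc[OF lim_const_over_n])
  define q where "q = (\<lambda>i x. (v (x + e i *\<^sub>R h) - v x) / e i)"
  define M where "M = R + norm h"
  have q_bound: "\<bar>q i x\<bar> \<le> indicator (cball 0 M) x * (L * norm h)" for i x
  proof (cases "norm x \<le> M")
    case True
    have "\<bar>v (x + e i *\<^sub>R h) - v x\<bar> \<le> L * (e i * norm h)"
      using lip[of "x + e i *\<^sub>R h" x] e(1)[of i] by simp
    then show ?thesis using True e(1)[of i] by (simp add: q_def field_simps)
  next
    case False
    have "norm (e i *\<^sub>R h) \<le> norm h"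
      using e[of i] by (simp add: mult_left_le_one_le)
    then have "norm (x + e i *\<^sub>R h) \<ge> R"
      using False norm_triangle_ineq4[of "x + e i *\<^sub>R h" "e i *\<^sub>R h"] by (simp add: M_def)
    moreover have "norm x \<ge> R" using False by (simp add: M_def) (use norm_ge_zero[of h] in linarith)
    ultimately show ?thesis using False by (simp add: q_def v_out)
  qed
  have ballint: "integrable lborel (\<lambda>x. indicator (cball 0 r) x * (k::real))" for r k
    by (intro integrable_mult_left integrable_real_indicator emeasure_lborel_cball_finite) auto
  have vint: "integrable lborel v"
  proof (rule Bochner_Integration.integrable_bound[OF ballint[of R "L * (2 * R)"]])
    show "AE x in lborel. norm (v x) \<le> norm (indicator (cball 0 R) x * (L * (2 * R)))"
    proof (rule AE_I2)
      fix x :: 'a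
      obtain b :: 'a where b: "b \<in> Basis" using nonempty_Basis by blast
      have "v (R *\<^sub>R b) = 0" using b R by (intro v_out) simp
      show "norm (v x) \<le> norm (indicator (cball 0 R) x * (L * (2 * R)))"
      proof (cases "norm x \<le> R")
        case True
        have "norm (x - R *\<^sub>R b) \<le> 2 * R"
          using norm_triangle_ineq4[of x "R *\<^sub>R b"] True b R by simp
        then have "L * norm (x - R *\<^sub>R b) \<le> L * (2 * R)" using L(1) by simp
        then have "\<bar>v x\<bar> \<le> L * (2 * R)"
          using lip[of x "R *\<^sub>R b"] \<open>v (R *\<^sub>R b) = 0\<close> by simp
        then show ?thesis using True L(1) R by simp
      qed (simp add: v_out)
    qed
  qed auto
  have vint': "integrable lborel (\<lambda>x. v (x + c))" for c
  proof -
    have "integrable (distr lborel borel ((+) c)) v" using vint by (simp add: lborel_distr_plus)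
    then show ?thesis by (subst (asm) integrable_distr_eq) (auto simp: add.commute)
  qed
  have q0: "(LINT x|lborel. q i x) = 0" for i
    unfolding q_def using vint vint' by (simp add: lborel_integral_translate)
  have "(\<lambda>i. LINT x|lborel. q i x) \<longlonglongrightarrow> (LINT x|lborel. indicator (ball 0 R) x * D x h)"
  proof (rule integral_dominated_convergence[OF _ _ ballint[of M "L * norm h"]])
    show "q i \<in> borel_measurable lborel" for i unfolding q_def by measurable
    show "AE x in lborel. norm (q i x) \<le> indicator (cball 0 M) x * (L * norm h)" for i
      using q_bound by simp
    have "sphere (0::'a) R \<in> null_sets lborel"
      using negligible_sphere[of "0::'a" R] by (auto simp: null_sets_completion_iff negligible_iff_null_sets)
    then have "AE x::'a in lborel. x \<notin> sphere 0 R" by (rule AE_not_in)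
    then show "AE x in lborel. (\<lambda>i. q i x) \<longlonglongrightarrow> indicator (ball 0 R) x * D x h"
    proof eventually_elim
      fix x :: 'a assume x: "x \<notin> sphere 0 R"
      have lim: "(\<lambda>i. x + e i *\<^sub>R h) \<longlonglongrightarrow> x + 0 *\<^sub>R h"
        by (intro tendsto_intros e0)
      show "(\<lambda>i. q i x) \<longlonglongrightarrow> indicator (ball 0 R) x * D x h"
      proof (cases "norm x < R")
        case True
        have "((\<lambda>t. u (x + t *\<^sub>R h)) has_derivative (\<lambda>t. D x (t *\<^sub>R h))) (at 0)"
          by (rule has_derivative_compose[of "\<lambda>t. x + t *\<^sub>R h" _ 0 UNIV u "D x", simplified])
             (auto intro!: derivative_eq_intros der)
        then have "((\<lambda>t. u (x + t *\<^sub>R h)) has_field_derivative D x h) (at 0)"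
          using linear_scale[OF has_derivative_linear[OF der[of x]]]
          by (simp add: has_field_derivative_def mult_commute_abs)
        then have "((\<lambda>t. (u (x + t *\<^sub>R h) - u x) / t) \<longlongrightarrow> D x h) (at 0)"
          by (simp add: DERIV_def)
        then have "(\<lambda>i. (u (x + e i *\<^sub>R h) - u x) / e i) \<longlonglongrightarrow> D x h"
          by (rule filterlim_compose) (use ne e0 in \<open>simp add: filterlim_at\<close>)
        moreover have "\<forall>\<^sub>F i in sequentially. x + e i *\<^sub>R h \<in> ball 0 R"
          using lim True by (intro topological_tendstoD[OF lim]) auto
        then have "\<forall>\<^sub>F i in sequentially. (u (x + e i *\<^sub>R h) - u x) / e i = q i x"
          by eventually_elim (use True in \<open>simp add: q_def v_in\<close>)
        ultimately have "(\<lambda>i. q i x) \<longlonglongrightarrow> D x h" by (rule Lim_transform_eventually)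
        then show ?thesis using True by simp
      next
        case False
        then have out: "norm x > R" using x by simp
        have "\<forall>\<^sub>F i in sequentially. x + e i *\<^sub>R h \<in> - cball 0 R"
          using lim out by (intro topological_tendstoD[OF lim]) auto
        then have "\<forall>\<^sub>F i in sequentially. 0 = q i x"
          by eventually_elim (use out in \<open>simp add: q_def v_out\<close>)
        then have "(\<lambda>i. q i x) \<longlonglongrightarrow> 0"
          by (rule Lim_transform_eventually[OF tendsto_const])
        then show ?thesis using out by simp
      qed
    qed
  qed (use Dm in \<open>auto intro!: borel_measurable_times borel_measurable_indicator\<close>)
  then have "(\<lambda>i. 0) \<longlonglongrightarrow> (LINT x|lborel. indicator (ball 0 R) x * D x h)" by (simp only: q0)
  then show ?thesis by (simp add: LIMSEQ_const_iff)
qed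

text \<open>The derivative is part of the notion, and continuous, so that the divergence theorem and the
  product rules apply; the sum over the basis is its trace.\<close>

definition has_divergence :: "('a::euclidean_space \<Rightarrow> 'a) \<Rightarrow> ('a \<Rightarrow> real) \<Rightarrow> bool" where
  "has_divergence F d \<longleftrightarrow> (\<exists>D. (\<forall>x. (F has_derivative D x) (at x)) \<and>
     (\<forall>h. continuous_on UNIV (\<lambda>x. D x h)) \<and> (\<forall>x. d x = (\<Sum>b\<in>Basis. D x b \<bullet> b)))"

lemma integrable_on_ball:
  fixes f :: "'a::euclidean_space \<Rightarrow> real"
  assumes "continuous_on UNIV f"
  shows "integrable lborel (\<lambda>x. indicator (ball 0 R) x * f x)"
proof -
  have "integrable lborel (\<lambda>x. indicator (cball 0 R) x *\<^sub>R f x)"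
    by (intro borel_integrable_compact continuous_on_subset[OF assms]) auto
  then have "integrable lborel (\<lambda>x. indicator (ball 0 R) x *\<^sub>R (indicator (cball 0 R) x *\<^sub>R f x))"
    by (rule integrable_mult_indicator[rotated]) simp
  also have "(\<lambda>x. indicator (ball 0 R) x *\<^sub>R (indicator (cball 0 R) x *\<^sub>R f x)) =
      (\<lambda>x. indicator (ball 0 R) x * f x)"
    by (auto simp: indicator_def)
  finally show ?thesis .
qed

lemma has_divergence_continuous:
  assumes "has_divergence F d"
  shows "continuous_on UNIV F" "continuous_on UNIV d"
proof -
  from assms obtain D where D: "\<And>x. (F has_derivative D x) (at x)"
    "\<And>h. continuous_on UNIV (\<lambda>x. D x h)" "\<And>x. d x = (\<Sum>b\<in>Basis. D x b \<bullet> b)"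
    unfolding has_divergence_def by blast
  show "continuous_on UNIV F"
    using D(1) by (intro continuous_at_imp_continuous_on ballI has_derivative_continuous)
  have "continuous_on UNIV (\<lambda>x. \<Sum>b\<in>Basis. D x b \<bullet> b)"
    by (intro continuous_intros D(2))
  moreover have "d = (\<lambda>x. \<Sum>b\<in>Basis. D x b \<bullet> b)" using D(3) by (rule ext)
  ultimately show "continuous_on UNIV d" by (simp only:)
qed

text \<open>The derivative of \<open>s ^ Suc k\<close> is of size \<open>k\<close> near \<open>s = 1\<close> only; the factor \<open>1 - s\<close> compensates for
  this. The bound dominates the derivative of the cutoff in the next proof.\<close>

lemma Suc_power_bound:
  fixes s :: real
  assumes "0 \<le> s" "s \<le> 1"
  shows "real (Suc k) * s ^ k * (1 - s) \<le> 1"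
proof -
  have "real (Suc k) * s ^ k = (\<Sum>j\<le>k. s ^ k)" by simp
  also have "\<dots> \<le> (\<Sum>j\<le>k. s ^ j)" using assms by (intro sum_mono power_decreasing) auto
  finally have "real (Suc k) * s ^ k * (1 - s) \<le> (\<Sum>j\<le>k. s ^ j) * (1 - s)"
    using assms by (intro mult_right_mono) auto
  also have "\<dots> = 1 - s ^ Suc k" by (subst mult.commute) (rule sum_gp_basic)
  also have "\<dots> \<le> 1" using assms by simp
  finally show ?thesis .
qed

text \<open>The fields \<open>(1 - (|x|\<^sup>2 / R\<^sup>2) ^ Suc k) F\<close> vanish on the sphere, so their divergences integrate to
  zero. As \<open>k\<close> grows they tend pointwise to \<open>div F\<close>. The term with the derivative of the cutoff stays
  bounded because \<open>x \<bullet> F x\<close>, being Lipschitz and zero on the sphere, is at most a multiple of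
  \<open>R\<^sup>2 - |x|\<^sup>2\<close>; dominated convergence concludes.\<close>

theorem divergence_theorem_tangential:
  fixes F :: "'a::euclidean_space \<Rightarrow> 'a"
  assumes R: "R > 0"
    and div: "has_divergence F d"
    and tangential: "\<And>x. norm x = R \<Longrightarrow> x \<bullet> F x = 0"
  shows "(LINT x|lborel. indicator (ball 0 R) x * d x) = 0"
proof -
  from div obtain D where der: "\<And>x. (F has_derivative D x) (at x)"
    and cont: "\<And>h. continuous_on UNIV (\<lambda>x. D x h)"
    and d: "\<And>x. d x = (\<Sum>b\<in>Basis. D x b \<bullet> b)"
    unfolding has_divergence_def by blast
  have Fcont: "continuous_on UNIV F" and dcont: "continuous_on UNIV d"
    using has_divergence_continuous[OF div] by auto
  have [measurable]: "F \<in> borel_measurable borel" "d \<in> borel_measurable borel"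
    using Fcont dcont by (auto intro: borel_measurable_continuous_onI)
  define s where "s = (\<lambda>x::'a. (x \<bullet> x) / R\<^sup>2)"
  define w where "w = (\<lambda>k x. (1 - s x ^ Suc k) * d x - real (Suc k) * s x ^ k * (2 * (x \<bullet> F x) / R\<^sup>2))"
  have s01: "0 \<le> s x" "s x < 1" if "x \<in> ball 0 R" for x
    using that R power_strict_mono[of "norm x" R 2]
    by (auto simp: s_def divide_simps dot_square_norm)
  have scont: "continuous_on UNIV s" unfolding s_def using R by (intro continuous_intros) auto
  then have [measurable]: "s \<in> borel_measurable borel" by (rule borel_measurable_continuous_onI)

  have sder: "(s has_derivative (\<lambda>h. 2 * (x \<bullet> h) / R\<^sup>2)) (at x)" for x
    unfolding s_def divide_inverse
    by (rule has_derivative_eq_rhs, rule has_derivative_mult_left, rule has_derivative_inner[OF has_derivative_ident has_derivative_ident])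
       (simp add: fun_eq_iff inner_commute)

  have zero: "(LINT x|lborel. indicator (ball 0 R) x * w k x) = 0" for k
  proof -
    define E where "E = (\<lambda>b x h. (1 - s x ^ Suc k) * (D x h \<bullet> b)
      - real (Suc k) * s x ^ k * (2 * (x \<bullet> h) / R\<^sup>2) * (F x \<bullet> b))"
    have E: "(LINT x|lborel. indicator (ball 0 R) x * E b x b) = 0" for b
    proof (rule integral_derivative_over_ball[where u = "\<lambda>x. (1 - s x ^ Suc k) * (F x \<bullet> b)" and D = "E b", OF R])
      fix x :: 'a
      have "((\<lambda>x. 1 - s x ^ Suc k) has_derivative
          (\<lambda>h. 0 - real (Suc k) * (2 * (x \<bullet> h) / R\<^sup>2) * s x ^ k)) (at x)"
        using has_derivative_diff[OF has_derivative_const has_derivative_power[OF sder, of "Suc k"]]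
        by (simp del: power_Suc)
      from has_derivative_mult[OF this has_derivative_inner_left[OF der, of b]]
      show "((\<lambda>x. (1 - s x ^ Suc k) * (F x \<bullet> b)) has_derivative E b x) (at x)"
        by (rule has_derivative_eq_rhs) (simp add: E_def fun_eq_iff mult_ac del: power_Suc)
    next
      show "continuous_on UNIV (\<lambda>x. E b x h)" for h
        unfolding E_def using R by (intro continuous_intros cont Fcont scont) auto
      show "(1 - s x ^ Suc k) * (F x \<bullet> b) = 0" if "norm x = R" for x
        using that R by (simp add: s_def dot_square_norm)
    qed
    have Econt: "continuous_on UNIV (\<lambda>x. E b x b)" for b
      unfolding E_def using R by (intro continuous_intros cont Fcont scont) auto
    have w: "w k x = (\<Sum>b\<in>Basis. E b x b)" for x
    proof -
      define p c where "p = 1 - s x ^ Suc k" and "c = real (Suc k) * s x ^ k"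
      have "(\<Sum>b\<in>Basis. E b x b) =
          (\<Sum>b\<in>Basis. p * (D x b \<bullet> b) - c * (2 / R\<^sup>2) * ((x \<bullet> b) * (F x \<bullet> b)))"
        by (simp add: E_def p_def c_def mult.assoc del: power_Suc)
      also have "\<dots> = p * d x - c * (2 / R\<^sup>2) * (x \<bullet> F x)"
        by (simp only: sum_subtractf sum_distrib_left[symmetric] d euclidean_inner[of x "F x"])
      finally show ?thesis by (simp add: w_def p_def c_def)
    qed
    have "(LINT x|lborel. indicator (ball 0 R) x * w k x) =
        (LINT x|lborel. (\<Sum>b\<in>Basis. indicator (ball 0 R) x * E b x b))"
      by (simp only: w sum_distrib_left)
    also have "\<dots> = (\<Sum>b\<in>Basis. LINT x|lborel. indicator (ball 0 R) x * E b x b)"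
      by (intro Bochner_Integration.integral_sum integrable_on_ball Econt)
    finally have "(LINT x|lborel. indicator (ball 0 R) x * w k x) =
        (\<Sum>b\<in>Basis. LINT x|lborel. indicator (ball 0 R) x * E b x b)" .
    then show ?thesis using E by simp
  qed

  obtain K where K: "K \<ge> 0" "\<And>x. x \<in> ball 0 R \<Longrightarrow> \<bar>x \<bullet> F x\<bar> \<le> K * (R\<^sup>2 * (1 - s x))"
  proof -
    have derN: "((\<lambda>x. x \<bullet> F x) has_derivative (\<lambda>h. x \<bullet> D x h + h \<bullet> F x)) (at x)" for x
      by (rule derivative_eq_intros der refl)+
    have contN: "continuous_on UNIV (\<lambda>x. x \<bullet> D x h + h \<bullet> F x)" for h
      by (intro continuous_intros cont Fcont)
    obtain L where L: "L > 0" "\<And>x y. x \<in> cball 0 R \<Longrightarrow> y \<in> cball 0 R \<Longrightarrow>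
        norm (x \<bullet> F x - y \<bullet> F y) \<le> L * norm (x - y)"
      using C1_lipschitz_on_cball[OF derN contN] by blast
    show thesis
    proof (rule that[of "L / R"])
      show "L / R \<ge> 0" using L R by simp
      fix x :: 'a assume x: "x \<in> ball 0 R"
      show "\<bar>x \<bullet> F x\<bar> \<le> L / R * (R\<^sup>2 * (1 - s x))"
      proof (cases "x = 0")
        case True
        then show ?thesis using L R by (simp add: s_def)
      next
        case False
        define y where "y = (R / norm x) *\<^sub>R x"
        have "norm y = R" using False R by (simp add: y_def)
        then have "\<bar>x \<bullet> F x\<bar> \<le> L * norm (x - y)"
          using L(2)[of x y] x tangential[of y] by simp
        also have "x - y = (1 - R / norm x) *\<^sub>R x" by (simp add: y_def algebra_simps)
        then have "norm (x - y) = \<bar>(1 - R / norm x) * norm x\<bar>" by (simp add: abs_mult)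
        also have "(1 - R / norm x) * norm x = norm x - R" using False by (simp add: field_simps)
        finally have "\<bar>x \<bullet> F x\<bar> \<le> L * (R - norm x)" using x by simp
        also have "(R - norm x) * 1 \<le> (R - norm x) * ((R + norm x) / R)"
          using R x by (intro mult_left_mono) auto
        then have "L * (R - norm x) \<le> L * ((R - norm x) * ((R + norm x) / R))"
          using L(1) by (intro mult_left_mono) auto
        also have "\<dots> = L / R * (R\<^sup>2 * (1 - s x))"
          using R by (simp add: s_def dot_square_norm field_simps power2_eq_square)
        finally show ?thesis .
      qed
    qed
  qed

  have "compact (d ` cball 0 R)"
    by (intro compact_continuous_image continuous_on_subset[OF dcont]) auto
  then obtain M where M: "M > 0" "\<And>x. x \<in> cball 0 R \<Longrightarrow> \<bar>d x\<bar> \<le> M"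
    by (auto simp: bounded_pos dest!: compact_imp_bounded)

  have "(\<lambda>k. LINT x|lborel. indicator (ball 0 R) x * w k x) \<longlonglongrightarrow>
      (LINT x|lborel. indicator (ball 0 R) x * d x)"
  proof (rule integral_dominated_convergence[where w = "\<lambda>x. indicator (ball 0 R) x * (M + 2 * K)"])
    show "(\<lambda>x. indicator (ball 0 R) x * w k x) \<in> borel_measurable lborel" for k
    proof -
      have "continuous_on UNIV (w k)"
        unfolding w_def using R by (intro continuous_intros dcont Fcont scont) auto
      then show ?thesis
        by (intro borel_measurable_times borel_measurable_indicator)
           (auto intro: borel_measurable_continuous_onI)
    qed
    show "integrable lborel (\<lambda>x::'a. indicator (ball 0 R) x * (M + 2 * K))"
      by (rule integrable_on_ball) auto
    show "AE x in lborel. norm (indicator (ball 0 R) x * w k x) \<le> indicator (ball 0 R) x * (M + 2 * K)" for k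
    proof (rule AE_I2)
      fix x :: 'a
      show "norm (indicator (ball 0 R) x * w k x) \<le> indicator (ball 0 R) x * (M + 2 * K)"
      proof (cases "x \<in> ball 0 R")
        case True
        note s = s01[OF True]
        define p q where "p = (1 - s x ^ Suc k) * d x"
          and "q = real (Suc k) * s x ^ k * (2 * (x \<bullet> F x) / R\<^sup>2)"
        have p: "\<bar>p\<bar> \<le> 1 * M"
          unfolding abs_mult p_def using s M(2)[of x] True
          by (intro mult_mono) (auto simp: abs_le_iff power_le_one simp del: power_Suc)
        have "\<bar>q\<bar> = real (Suc k) * s x ^ k * (2 * \<bar>x \<bullet> F x\<bar> / R\<^sup>2)"
          using s by (simp add: abs_mult q_def)
        also have "\<dots> \<le> real (Suc k) * s x ^ k * (2 * (K * (R\<^sup>2 * (1 - s x))) / R\<^sup>2)"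
          using K(2)[OF True] s by (intro mult_left_mono divide_right_mono) auto
        also have "\<dots> = 2 * K * (real (Suc k) * s x ^ k * (1 - s x))"
          using R by (simp add: field_simps)
        also have "\<dots> \<le> 2 * K * 1"
          using K(1) s by (intro mult_left_mono Suc_power_bound) auto
        finally have "\<bar>p - q\<bar> \<le> M + 2 * K" using p by linarith
        then have "\<bar>w k x\<bar> \<le> M + 2 * K" by (simp only: w_def p_def q_def)
        then show ?thesis using True by simp
      qed auto
    qed
    show "AE x in lborel. (\<lambda>k. indicator (ball 0 R) x * w k x) \<longlonglongrightarrow> indicator (ball 0 R) x * d x"
    proof (rule AE_I2)
      fix x :: 'a
      show "(\<lambda>k. indicator (ball 0 R) x * w k x) \<longlonglongrightarrow> indicator (ball 0 R) x * d x"
      proof (cases "x \<in> ball 0 R")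
        case True
        note s = s01[OF True]
        have p: "(\<lambda>k. s x ^ k) \<longlonglongrightarrow> 0" using s by (intro LIMSEQ_realpow_zero) auto
        have q: "(\<lambda>k. real k * s x ^ k) \<longlonglongrightarrow> 0" using s by (intro powser_times_n_limit_0) auto
        have "(\<lambda>k. (1 - s x ^ k * s x) * d x - (real k * s x ^ k + s x ^ k) * (2 * (x \<bullet> F x) / R\<^sup>2))
            \<longlonglongrightarrow> (1 - 0 * s x) * d x - (0 + 0) * (2 * (x \<bullet> F x) / R\<^sup>2)"
          by (intro tendsto_intros p q)
        then show ?thesis using True by (simp add: w_def algebra_simps)
      qed auto
    qed
  qed (auto intro!: borel_measurable_times borel_measurable_indicator)
  then have "(\<lambda>k. 0) \<longlonglongrightarrow> (LINT x|lborel. indicator (ball 0 R) x * d x)" by (simp only: zero)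
  then show ?thesis by (simp add: LIMSEQ_const_iff)
qed

section \<open>Rules for gradients, divergences and Laplacians\<close>

definition has_gradient :: "('a::euclidean_space \<Rightarrow> real) \<Rightarrow> ('a \<Rightarrow> 'a) \<Rightarrow> bool" where
  "has_gradient f G \<longleftrightarrow> continuous_on UNIV G \<and> (\<forall>x. GDERIV f x :> G x)"

lemma has_gradient_continuous: "has_gradient f G \<Longrightarrow> continuous_on UNIV f"
  unfolding has_gradient_def gderiv_def
  by (meson continuous_at_imp_continuous_on has_derivative_continuous)

lemma has_gradient_imp_grad: "has_gradient f G \<Longrightarrow> grad f x = G x"
proof -
  assume "has_gradient f G"
  then have G: "GDERIV f x :> G x" by (simp add: has_gradient_def)
  have "E = G x" if "GDERIV f x :> E" for E
  proof -
    have "(\<lambda>h. h \<bullet> E) = (\<lambda>h. h \<bullet> G x)"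
      using that G unfolding gderiv_def by (rule has_derivative_unique)
    then show ?thesis by (metis vector_eq_ldot)
  qed
  then show ?thesis unfolding grad_def using G by blast
qed

lemma has_gradient_const: "has_gradient (\<lambda>_. c) (\<lambda>_. 0)"
  by (simp add: has_gradient_def GDERIV_const)

lemma has_gradient_inner: "has_gradient (\<lambda>x. x \<bullet> a) (\<lambda>_. a)"
  unfolding has_gradient_def gderiv_def by (auto intro!: derivative_eq_intros)

lemma has_gradient_square: "has_gradient (\<lambda>x. x \<bullet> x) (\<lambda>x. 2 *\<^sub>R x)"
  unfolding has_gradient_def gderiv_def
  by (auto intro!: derivative_eq_intros continuous_intros simp: inner_commute)

lemma has_gradient_mult:
  assumes "has_gradient f F" "has_gradient g G"
  shows "has_gradient (\<lambda>x. f x * g x) (\<lambda>x. f x *\<^sub>R G x + g x *\<^sub>R F x)"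
  using assms has_gradient_continuous[OF assms(1)] has_gradient_continuous[OF assms(2)]
  unfolding has_gradient_def by (auto intro!: continuous_intros GDERIV_mult)

lemma has_gradient_cmult:
  "has_gradient f F \<Longrightarrow> has_gradient (\<lambda>x. c * f x) (\<lambda>x. c *\<^sub>R F x)"
  using has_gradient_mult[OF has_gradient_const[of c]] by fastforce

lemma has_gradient_diff:
  assumes "has_gradient f F" "has_gradient g G"
  shows "has_gradient (\<lambda>x. f x - g x) (\<lambda>x. F x - G x)"
  using assms unfolding has_gradient_def by (auto intro!: continuous_intros GDERIV_diff)

lemma has_gradient_add:
  assumes "has_gradient f F" "has_gradient g G"
  shows "has_gradient (\<lambda>x. f x + g x) (\<lambda>x. F x + G x)"
  using assms unfolding has_gradient_def by (auto intro!: continuous_intros GDERIV_add)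

lemma has_gradient_sum:
  assumes "\<And>i. i \<in> I \<Longrightarrow> has_gradient (f i) (F i)"
  shows "has_gradient (\<lambda>x. \<Sum>i\<in>I. f i x) (\<lambda>x. \<Sum>i\<in>I. F i x)"
  using assms
  by (induction I rule: infinite_finite_induct) (auto intro: has_gradient_const has_gradient_add)

lemma has_gradient_compose:
  assumes f: "has_gradient f F"
    and \<phi>: "\<And>t. (\<phi> has_field_derivative \<phi>' t) (at t)" "continuous_on UNIV \<phi>'"
  shows "has_gradient (\<lambda>x. \<phi> (f x)) (\<lambda>x. \<phi>' (f x) *\<^sub>R F x)"
proof -
  have "continuous_on UNIV (\<lambda>x. \<phi>' (f x))"
    using \<phi>(2) has_gradient_continuous[OF f] by (rule continuous_on_compose2) auto
  then show ?thesis
    using f GDERIV_DERIV_compose[OF _ \<phi>(1)] unfolding has_gradient_def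
    by (auto intro!: continuous_intros)
qed

lemma has_divergence_const: "has_divergence (\<lambda>_. a) (\<lambda>_. 0)"
  unfolding has_divergence_def by (rule exI[of _ "\<lambda>_ _. 0"]) auto

lemma has_divergence_linear:
  fixes A :: "'a::euclidean_space \<Rightarrow> 'a"
  assumes "linear A"
  shows "has_divergence A (\<lambda>_. \<Sum>b\<in>Basis. A b \<bullet> b)"
  unfolding has_divergence_def
  by (rule exI[of _ "\<lambda>_. A"])
     (use assms in \<open>auto intro!: linear_imp_has_derivative\<close>)

lemma has_divergence_add:
  assumes "has_divergence F d" "has_divergence G e"
  shows "has_divergence (\<lambda>x. F x + G x) (\<lambda>x. d x + e x)"
proof -
  from assms(1) obtain D where "\<And>x. (F has_derivative D x) (at x)"
    "\<And>h. continuous_on UNIV (\<lambda>x. D x h)" "\<And>x. d x = (\<Sum>b\<in>Basis. D x b \<bullet> b)"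
    unfolding has_divergence_def by blast
  moreover from assms(2) obtain E where "\<And>x. (G has_derivative E x) (at x)"
    "\<And>h. continuous_on UNIV (\<lambda>x. E x h)" "\<And>x. e x = (\<Sum>b\<in>Basis. E x b \<bullet> b)"
    unfolding has_divergence_def by blast
  ultimately show ?thesis
    unfolding has_divergence_def
    by (intro exI[of _ "\<lambda>x h. D x h + E x h"])
       (auto intro!: derivative_intros continuous_intros simp: inner_add_left sum.distrib)
qed

lemma has_divergence_scale:
  assumes f: "has_gradient f G" and F: "has_divergence F d"
  shows "has_divergence (\<lambda>x. f x *\<^sub>R F x) (\<lambda>x. G x \<bullet> F x + f x * d x)"
proof -
  from F obtain D where D: "\<And>x. (F has_derivative D x) (at x)"
    "\<And>h. continuous_on UNIV (\<lambda>x. D x h)" "\<And>x. d x = (\<Sum>b\<in>Basis. D x b \<bullet> b)"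
    unfolding has_divergence_def by blast
  have G: "\<And>x. (f has_derivative (\<lambda>h. h \<bullet> G x)) (at x)" "continuous_on UNIV G"
    using f unfolding has_gradient_def gderiv_def by auto
  have cont: "continuous_on UNIV (\<lambda>x. f x *\<^sub>R D x h + (h \<bullet> G x) *\<^sub>R F x)" for h
    by (intro continuous_intros D G has_gradient_continuous[OF f] has_divergence_continuous(1)[OF F])
  have eq: "G x \<bullet> F x + f x * d x = (\<Sum>b\<in>Basis. (f x *\<^sub>R D x b + (b \<bullet> G x) *\<^sub>R F x) \<bullet> b)" for x
    by (simp add: D(3) inner_add_left sum.distrib sum_distrib_left euclidean_inner[of "G x" "F x"]
        inner_commute[of _ "G x"])
  show ?thesis
    unfolding has_divergence_def
    by (rule exI[of _ "\<lambda>x h. f x *\<^sub>R D x h + (h \<bullet> G x) *\<^sub>R F x"])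
       (use cont eq in \<open>auto intro!: has_derivative_scaleR G D\<close>)
qed

lemma has_divergence_cscale:
  "has_divergence F d \<Longrightarrow> has_divergence (\<lambda>x. c *\<^sub>R F x) (\<lambda>x. c * d x)"
  using has_divergence_scale[OF has_gradient_const[of c]] by fastforce

lemma has_divergence_diff:
  assumes "has_divergence F d" "has_divergence G e"
  shows "has_divergence (\<lambda>x. F x - G x) (\<lambda>x. d x - e x)"
  using has_divergence_add[OF assms(1) has_divergence_cscale[OF assms(2), of "-1"]] by simp

lemma has_divergence_sum:
  assumes "\<And>i. i \<in> I \<Longrightarrow> has_divergence (F i) (d i)"
  shows "has_divergence (\<lambda>x. \<Sum>i\<in>I. F i x) (\<lambda>x. \<Sum>i\<in>I. d i x)"
  using assms
  by (induction I rule: infinite_finite_induct) (auto intro: has_divergence_const has_divergence_add)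

lemma has_divergence_position: "has_divergence (\<lambda>x::'a::euclidean_space. x) (\<lambda>_. real DIM('a))"
  using has_divergence_linear[of "\<lambda>x::'a. x"] by (simp add: linear_ident cong: sum.cong)

lemma has_divergence_imp_divergence:
  assumes "has_divergence F d"
  shows "F differentiable (at x)" "divergence F x = d x"
proof -
  from assms obtain D where D: "\<And>x. (F has_derivative D x) (at x)"
    "\<And>x. d x = (\<Sum>b\<in>Basis. D x b \<bullet> b)"
    unfolding has_divergence_def by blast
  show "F differentiable (at x)" using D(1) by (rule differentiableI)
  have "frechet_derivative F (at x) = D x" using frechet_derivative_at[OF D(1)] by simp
  then show "divergence F x = d x" by (simp add: divergence_def D(2))
qed

text \<open>Gradient and Laplacian are carried along together, so that the Laplacian of a product can be read off
  from its factors.\<close>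

definition has_grad_lap ::
  "('a::euclidean_space \<Rightarrow> real) \<Rightarrow> ('a \<Rightarrow> 'a) \<Rightarrow> ('a \<Rightarrow> real) \<Rightarrow> bool" where
  "has_grad_lap f G l \<longleftrightarrow> has_gradient f G \<and> has_divergence G l"

lemma has_grad_lap_mult:
  assumes "has_grad_lap f F k" "has_grad_lap g G l"
  shows "has_grad_lap (\<lambda>x. f x * g x) (\<lambda>x. f x *\<^sub>R G x + g x *\<^sub>R F x)
    (\<lambda>x. f x * l x + 2 * (F x \<bullet> G x) + g x * k x)"
proof -
  have "has_divergence (\<lambda>x. f x *\<^sub>R G x + g x *\<^sub>R F x)
      (\<lambda>x. (F x \<bullet> G x + f x * l x) + (G x \<bullet> F x + g x * k x))"
    using assms unfolding has_grad_lap_def by (intro has_divergence_add has_divergence_scale) auto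
  also have "(\<lambda>x. (F x \<bullet> G x + f x * l x) + (G x \<bullet> F x + g x * k x)) =
      (\<lambda>x. f x * l x + 2 * (F x \<bullet> G x) + g x * k x)"
    by (simp add: fun_eq_iff inner_commute)
  finally show ?thesis
    using assms unfolding has_grad_lap_def by (auto intro: has_gradient_mult)
qed

lemma has_grad_lap_compose:
  assumes f: "has_grad_lap f F l"
    and \<phi>: "\<And>t. (\<phi> has_field_derivative \<phi>' t) (at t)"
      "\<And>t. (\<phi>' has_field_derivative \<phi>'' t) (at t)" "continuous_on UNIV \<phi>''"
  shows "has_grad_lap (\<lambda>x. \<phi> (f x)) (\<lambda>x. \<phi>' (f x) *\<^sub>R F x)
    (\<lambda>x. \<phi>'' (f x) * (F x \<bullet> F x) + \<phi>' (f x) * l x)"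
proof -
  have g: "has_gradient f F" "has_divergence F l" using f by (auto simp: has_grad_lap_def)
  have "continuous_on UNIV \<phi>'"
    by (rule DERIV_continuous_on) (use \<phi>(2) in \<open>auto intro: has_field_derivative_at_within\<close>)
  then have "has_gradient (\<lambda>x. \<phi> (f x)) (\<lambda>x. \<phi>' (f x) *\<^sub>R F x)"
    using has_gradient_compose[OF g(1) \<phi>(1)] by simp
  moreover have "has_divergence (\<lambda>x. \<phi>' (f x) *\<^sub>R F x)
      (\<lambda>x. (\<phi>'' (f x) *\<^sub>R F x) \<bullet> F x + \<phi>' (f x) * l x)"
    using has_gradient_compose[OF g(1) \<phi>(2,3)] g(2) by (rule has_divergence_scale)
  ultimately show ?thesis by (simp add: has_grad_lap_def)
qed

lemma has_grad_lap_add: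
  assumes "has_grad_lap f F k" "has_grad_lap g G l"
  shows "has_grad_lap (\<lambda>x. f x + g x) (\<lambda>x. F x + G x) (\<lambda>x. k x + l x)"
  using assms unfolding has_grad_lap_def by (auto intro: has_gradient_add has_divergence_add)

lemma has_grad_lap_diff:
  assumes "has_grad_lap f F k" "has_grad_lap g G l"
  shows "has_grad_lap (\<lambda>x. f x - g x) (\<lambda>x. F x - G x) (\<lambda>x. k x - l x)"
  using assms unfolding has_grad_lap_def by (auto intro: has_gradient_diff has_divergence_diff)

lemma has_grad_lap_cmult:
  assumes "has_grad_lap f F k"
  shows "has_grad_lap (\<lambda>x. c * f x) (\<lambda>x. c *\<^sub>R F x) (\<lambda>x. c * k x)"
  using assms unfolding has_grad_lap_def by (auto intro: has_gradient_cmult has_divergence_cscale)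

lemma has_grad_lap_sum:
  assumes "\<And>i. i \<in> I \<Longrightarrow> has_grad_lap (f i) (F i) (k i)"
  shows "has_grad_lap (\<lambda>x. \<Sum>i\<in>I. f i x) (\<lambda>x. \<Sum>i\<in>I. F i x) (\<lambda>x. \<Sum>i\<in>I. k i x)"
  using assms unfolding has_grad_lap_def by (auto intro: has_gradient_sum has_divergence_sum)

lemma has_grad_lap_const: "has_grad_lap (\<lambda>_. c) (\<lambda>_. 0) (\<lambda>_. 0)"
  unfolding has_grad_lap_def by (auto intro: has_gradient_const has_divergence_const)

lemma has_grad_lap_inner: "has_grad_lap (\<lambda>x. x \<bullet> a) (\<lambda>_. a) (\<lambda>_. 0)"
  unfolding has_grad_lap_def by (auto intro: has_gradient_inner has_divergence_const)

lemma has_grad_lap_square: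
  "has_grad_lap (\<lambda>x::'a::euclidean_space. x \<bullet> x) (\<lambda>x. 2 *\<^sub>R x) (\<lambda>_. 2 * real DIM('a))"
  unfolding has_grad_lap_def
  by (auto intro: has_gradient_square has_divergence_cscale[OF has_divergence_position])

lemma has_grad_lap_power:
  assumes "has_grad_lap f F l"
  shows "has_grad_lap (\<lambda>x. f x ^ m) (\<lambda>x. (real m * f x ^ (m - 1)) *\<^sub>R F x)
    (\<lambda>x. real m * (real (m - 1) * f x ^ (m - 2)) * (F x \<bullet> F x) + real m * f x ^ (m - 1) * l x)"
  by (rule has_grad_lap_compose[OF assms, of "\<lambda>t. t ^ m" "\<lambda>t. real m * t ^ (m - 1)"
        "\<lambda>t. real m * (real (m - 1) * t ^ (m - 2))"])
     (auto intro!: derivative_eq_intros continuous_intros simp: numeral_2_eq_2)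

section \<open>The radial functions and the zeros of their derivatives\<close>

definition sinc_coeff :: "nat \<Rightarrow> 'a::{real_normed_field,banach}" where
  "sinc_coeff j = (- 1) ^ j / fact (2 * j + 1)"

text \<open>This is the \<open>n\<close>-th derivative of the entire function with value \<open>sin (sqrt t) / sqrt t\<close> for \<open>t > 0\<close>.
  The type is generic because the real function carries the analysis and the complex one the isolation
  of zeros.\<close>

definition sinc_sqrt :: "nat \<Rightarrow> 'a::{real_normed_field,banach} \<Rightarrow> 'a" where
  "sinc_sqrt n t = (\<Sum>j. (diffs ^^ n) sinc_coeff j * t ^ j)"

lemma summable_sinc_sqrt:
  "summable (\<lambda>j. (diffs ^^ n) sinc_coeff j * t ^ j :: 'a::{real_normed_field,banach})"
proof (induction n arbitrary: t)
  case 0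
  have "summable (\<lambda>j. inverse (fact j) * norm t ^ j)" by (rule summable_exp)
  moreover have "norm (sinc_coeff j * t ^ j) \<le> inverse (fact j) * norm t ^ j" for j
  proof -
    have "fact j \<le> (fact (2 * j + 1) :: real)" by (rule fact_mono) simp
    then have "1 / fact (2 * j + 1) \<le> (1 / fact j :: real)" by (intro divide_left_mono) auto
    then have "1 / fact (2 * j + 1) * norm t ^ j \<le> 1 / fact j * norm t ^ j"
      by (intro mult_right_mono) auto
    then show ?thesis
      by (simp add: sinc_coeff_def norm_mult norm_divide norm_power norm_fact inverse_eq_divide del: fact_Suc)
  qed
  ultimately have "summable (\<lambda>j. sinc_coeff j * t ^ j)" by (rule summable_comparison_test')
  then show ?case by simp
next
  case (Suc n)
  then show ?case using termdiff_converges_all[of "(diffs ^^ n) sinc_coeff" t] by simp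
qed

lemma DERIV_sinc_sqrt: "(sinc_sqrt n has_field_derivative sinc_sqrt (Suc n) t) (at t)"
  using termdiffs_strong_converges_everywhere[of "(diffs ^^ n) sinc_coeff" t, OF summable_sinc_sqrt]
  by (simp add: sinc_sqrt_def[abs_def])

lemma continuous_sinc_sqrt [continuous_intros]:
  "continuous_on A f \<Longrightarrow> continuous_on A (\<lambda>x. sinc_sqrt n (f x))"
proof -
  assume f: "continuous_on A f"
  have "continuous_on UNIV (sinc_sqrt n :: 'b \<Rightarrow> 'b)"
    using DERIV_sinc_sqrt by (auto intro: continuous_at_imp_continuous_on DERIV_isCont)
  then show ?thesis using f by (rule continuous_on_compose2) auto
qed

lemma sinc_sqrt_at_0_nonzero: "sinc_sqrt n (0::'a::{real_normed_field,banach}) \<noteq> 0"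
proof -
  have "(diffs ^^ n) sinc_coeff j \<noteq> (0::'a)" for j
    by (induction n arbitrary: j) (auto simp: sinc_coeff_def diffs_def simp del: of_nat_Suc)
  then show ?thesis by (simp add: sinc_sqrt_def)
qed

lemma sinc_sqrt_of_real:
  "sinc_sqrt n (of_real t) = (of_real (sinc_sqrt n t) :: 'a::{real_normed_field,banach})"
proof -
  have "(diffs ^^ n) sinc_coeff j = (of_real ((diffs ^^ n) sinc_coeff j) :: 'a)" for j
    by (induction n arbitrary: j) (auto simp: sinc_coeff_def diffs_def)
  then show ?thesis
    unfolding sinc_sqrt_def
    by (subst suminf_of_real[OF summable_sinc_sqrt]) simp
qed

lemma sin_eq_sinc_sqrt: "sin z = z * sinc_sqrt 0 (z\<^sup>2)" for z :: real
proof -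
  have "(\<lambda>j. z * (sinc_coeff j * (z\<^sup>2) ^ j)) sums (z * sinc_sqrt 0 (z\<^sup>2))"
    unfolding sinc_sqrt_def using summable_sinc_sqrt[of 0 "z\<^sup>2"]
    by (intro sums_mult summable_sums) auto
  also have "(\<lambda>j. z * (sinc_coeff j * (z\<^sup>2) ^ j)) = (\<lambda>j. (- 1) ^ j / fact (2 * j + 1) * z ^ (2 * j + 1))"
    by (simp add: fun_eq_iff sinc_coeff_def power_mult)
  finally show ?thesis using sin_paired[of z] sums_unique2 by blast
qed

text \<open>For \<open>n = 0\<close> this is the recursion between consecutive coefficients; differentiating the equation
  takes \<open>n\<close> to \<open>n + 1\<close>.\<close>

lemma sinc_sqrt_ode:
  "4 * t * sinc_sqrt (n + 2) t + (4 * real n + 6) * sinc_sqrt (n + 1) t + sinc_sqrt n t = 0"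
proof (induction n arbitrary: t)
  case 0
  let ?c = "sinc_coeff :: nat \<Rightarrow> real"
  have c: "?c j = - (2 * real j + 2) * (2 * real j + 3) * ?c (Suc j)" for j
  proof -
    define a b where "a = 2 * real j + 2" and "b = 2 * real j + 3"
    have "fact (2 * Suc j + 1) = b * a * fact (2 * j + 1)"
      by (simp add: a_def b_def algebra_simps)
    moreover have "a \<noteq> 0" "b \<noteq> 0" by (auto simp: a_def b_def)
    ultimately have "?c j = - a * b * ?c (Suc j)"
      by (simp add: sinc_coeff_def field_simps del: fact_Suc)
    then show ?thesis by (simp add: a_def b_def)
  qed
  have S: "(\<lambda>j. (diffs ^^ k) ?c j * t ^ j) sums sinc_sqrt k t" for k
    unfolding sinc_sqrt_def using summable_sinc_sqrt by (rule summable_sums)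
  define f where "f = (\<lambda>j. real j * diffs ?c j * t ^ j)"
  have "(\<lambda>j. t * ((diffs ^^ 2) ?c j * t ^ j)) = (\<lambda>j. f (Suc j))"
    by (simp add: f_def fun_eq_iff numeral_2_eq_2 diffs_def)
  then have "(\<lambda>j. f (Suc j)) sums (t * sinc_sqrt 2 t)"
    using sums_mult[OF S[of 2], of t] by simp
  then have S2: "(\<lambda>j. real j * diffs ?c j * t ^ j) sums (t * sinc_sqrt 2 t)"
    unfolding sums_Suc_iff by (simp add: f_def)
  have "(\<lambda>j. 4 * (real j * diffs ?c j * t ^ j) + 6 * (diffs ?c j * t ^ j) + ?c j * t ^ j) sums
      (4 * (t * sinc_sqrt 2 t) + 6 * sinc_sqrt 1 t + sinc_sqrt 0 t)"
    using S[of 1] S[of 0] by (intro sums_add sums_mult S2) auto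
  then have "4 * (t * sinc_sqrt 2 t) + 6 * sinc_sqrt 1 t + sinc_sqrt 0 t =
     (\<Sum>j. 4 * (real j * diffs ?c j * t ^ j) + 6 * (diffs ?c j * t ^ j) + ?c j * t ^ j)"
    by (rule sums_unique)
  moreover have "4 * (real j * diffs ?c j * t ^ j) + 6 * (diffs ?c j * t ^ j) + ?c j * t ^ j = 0" for j
    by (subst c) (simp add: diffs_def algebra_simps)
  then have "(\<Sum>j. 4 * (real j * diffs ?c j * t ^ j) + 6 * (diffs ?c j * t ^ j) + ?c j * t ^ j) = 0"
    by simp
  ultimately show ?case by (simp add: numeral_2_eq_2 mult_ac)
next
  case (Suc n)
  have "((\<lambda>t. 4 * t * sinc_sqrt (n + 2) t + (4 * real n + 6) * sinc_sqrt (n + 1) t + sinc_sqrt n t)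
     has_real_derivative (4 * t * sinc_sqrt (n + 3) t + (4 * real (Suc n) + 6) * sinc_sqrt (n + 2) t
        + sinc_sqrt (n + 1) t)) (at t)"
    by (rule derivative_eq_intros DERIV_sinc_sqrt refl)+
       (simp add: algebra_simps eval_nat_numeral)
  then have "((\<lambda>t. 0) has_real_derivative (4 * t * sinc_sqrt (n + 3) t + (4 * real (Suc n) + 6) * sinc_sqrt (n + 2) t
        + sinc_sqrt (n + 1) t)) (at t)"
    unfolding Suc.IH .
  then have "4 * t * sinc_sqrt (n + 3) t + (4 * real (Suc n) + 6) * sinc_sqrt (n + 2) t
        + sinc_sqrt (n + 1) t = 0"
    using DERIV_unique[OF _ DERIV_const] by blast
  then show ?case by (simp add: eval_nat_numeral)
qed

text \<open>On functions of \<open>z\<^sup>2\<close> the operator \<open>d / (z dz)\<close> is twice the derivative with respect to \<open>z\<^sup>2\<close>.\<close>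

lemma iterated_sinc_operator:
  "z \<noteq> 0 \<Longrightarrow> ((\<lambda>f w. deriv f w / w) ^^ n) (\<lambda>w. sin w / w) z = 2 ^ n * sinc_sqrt n (z\<^sup>2)"
  for z :: real
proof (induction n arbitrary: z)
  case 0
  then show ?case by (simp add: sin_eq_sinc_sqrt)
next
  case (Suc n)
  let ?f = "((\<lambda>f w. deriv f w / w) ^^ n) (\<lambda>w. sin w / w) :: real \<Rightarrow> real"
  have "((\<lambda>w. 2 ^ n * sinc_sqrt n (w\<^sup>2)) has_real_derivative
      2 ^ n * (sinc_sqrt (Suc n) (z\<^sup>2) * (2 * z))) (at z)"
    by (rule derivative_eq_intros DERIV_chain2[OF DERIV_sinc_sqrt] refl)+ simp
  moreover have "\<forall>\<^sub>F w in nhds z. ?f w = 2 ^ n * sinc_sqrt n (w\<^sup>2)"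
    using t1_space_nhds[OF Suc.prems] by eventually_elim (rule Suc.IH)
  ultimately have "(?f has_real_derivative 2 ^ n * (sinc_sqrt (Suc n) (z\<^sup>2) * (2 * z))) (at z)"
    by (subst DERIV_cong_ev[OF refl _ refl])
  then show ?case using Suc.prems by (simp add: DERIV_imp_deriv)
qed

text \<open>The right-hand side is continuous at the origin, so it agrees there with the limit in the
  definition of \<open>psi\<close>.\<close>

lemma psi_eq: "psi n z = (- 2 * z) ^ n * sinc_sqrt n (z\<^sup>2)"
proof -
  have f: "psi_formula n w = (- 2 * w) ^ n * sinc_sqrt n (w\<^sup>2)" if "w \<noteq> 0" for w
  proof -
    have "(- 2 * w) ^ n = (- w) ^ n * 2 ^ n"
      by (subst power_mult_distrib[symmetric]) (simp add: mult.commute)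
    then show ?thesis using that by (simp add: psi_formula_def iterated_sinc_operator)
  qed
  have "((\<lambda>w. (- 2 * w) ^ n * sinc_sqrt n (w\<^sup>2)) \<longlongrightarrow> (- 2 * 0) ^ n * sinc_sqrt n (0\<^sup>2)) (at (0::real))"
    by (rule isContD, rule continuous_on_interior[of UNIV]) (auto intro!: continuous_intros)
  then have "(psi_formula n \<longlongrightarrow> (- 2 * 0) ^ n * sinc_sqrt n (0\<^sup>2)) (at 0)"
    by (rule Lim_transform_eventually) (auto simp: f eventually_at intro!: exI[of _ 1])
  then have "Lim (at 0) (psi_formula n) = (- 2 * 0) ^ n * sinc_sqrt n (0\<^sup>2)"
    by (intro tendsto_Lim) auto
  then show ?thesis by (auto simp: psi_def f)
qed

definition psi_deriv :: "nat \<Rightarrow> 'a::{real_normed_field,banach} \<Rightarrow> 'a" where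
  "psi_deriv n z = of_nat n * (- 2) * (- 2 * z) ^ (n - 1) * sinc_sqrt n (z\<^sup>2)
     + (- 2 * z) ^ n * sinc_sqrt (Suc n) (z\<^sup>2) * (2 * z)"

lemma DERIV_psi: "(psi n has_real_derivative psi_deriv n z) (at z)"
  unfolding psi_eq[abs_def]
  by (rule derivative_eq_intros DERIV_chain2[OF DERIV_sinc_sqrt] refl)+
     (simp add: psi_deriv_def algebra_simps)

lemma deriv_psi: "deriv (psi n) z = psi_deriv n z"
  using DERIV_psi by (rule DERIV_imp_deriv)

lemma continuous_psi_deriv: "continuous_on A (psi_deriv n)"
  unfolding psi_deriv_def by (intro continuous_intros)

text \<open>For \<open>n = 0\<close> these are the zeros of the sine. Between two positive zeros of
  \<open>sinc_sqrt n (z\<^sup>2)\<close> its derivative \<open>2 z sinc_sqrt (n + 1) (z\<^sup>2)\<close> vanishes.\<close>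

lemma sinc_sqrt_zeros_unbounded: "\<exists>z>M. sinc_sqrt n (z\<^sup>2) = (0::real)"
proof (induction n arbitrary: M)
  case 0
  obtain k :: nat where k: "real k * pi > max M 0"
    using reals_Archimedean3[of pi] pi_gt_zero by blast
  have "sin (real k * pi) = 0" by simp
  then have "sinc_sqrt 0 ((real k * pi)\<^sup>2) = 0"
    using k unfolding sin_eq_sinc_sqrt by auto
  then show ?case using k by (intro exI[of _ "real k * pi"]) auto
next
  case (Suc n)
  obtain a where a: "a > max M 0" "sinc_sqrt n (a\<^sup>2) = 0" using Suc by blast
  obtain b where b: "b > a" "sinc_sqrt n (b\<^sup>2) = 0" using Suc by blast
  have der: "((\<lambda>w. sinc_sqrt n (w\<^sup>2)) has_real_derivative sinc_sqrt (Suc n) (w\<^sup>2) * (2 * w)) (at w)"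
    for w :: real
    by (rule derivative_eq_intros DERIV_chain2[OF DERIV_sinc_sqrt] refl)+ simp
  obtain z where z: "a < z" "z < b" "((\<lambda>w. sinc_sqrt n (w\<^sup>2)) has_real_derivative 0) (at z)"
  proof -
    have "\<exists>z. a < z \<and> z < b \<and> ((\<lambda>w. sinc_sqrt n (w\<^sup>2)) has_real_derivative 0) (at z)"
    proof (rule Rolle)
      show "(\<lambda>w. sinc_sqrt n (w\<^sup>2)) differentiable (at x)" for x :: real
        using der unfolding real_differentiable_def by blast
    qed (use a b in \<open>auto intro!: continuous_intros\<close>)
    then show thesis using that by blast
  qed
  then have "sinc_sqrt (Suc n) (z\<^sup>2) * (2 * z) = 0" using der DERIV_unique by blast
  then show ?case using z a by (intro exI[of _ z]) auto
qed

lemma psi_deriv_zeros_unbounded: "\<exists>z>M. psi_deriv n z = (0::real)"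
proof -
  obtain a where a: "a > M" "sinc_sqrt n (a\<^sup>2) = 0" using sinc_sqrt_zeros_unbounded by blast
  obtain b where b: "b > a" "sinc_sqrt n (b\<^sup>2) = 0" using sinc_sqrt_zeros_unbounded by blast
  have "\<exists>z. a < z \<and> z < b \<and> (psi n has_real_derivative 0) (at z)"
  proof (rule Rolle)
    show "continuous_on {a..b} (psi n)"
      using DERIV_psi by (auto intro: continuous_at_imp_continuous_on DERIV_isCont)
    show "psi n differentiable (at x)" for x
      using DERIV_psi unfolding real_differentiable_def by blast
  qed (use a b in \<open>auto simp: psi_eq\<close>)
  then show ?thesis using DERIV_psi DERIV_unique a by (metis less_trans)
qed

lemma psi_deriv_not_identically_zero: "\<exists>z::real. psi_deriv n z \<noteq> 0"
proof (rule ccontr)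
  assume "\<not> ?thesis"
  then have const: "psi n z = psi n w" for z w
    using DERIV_psi[of n] by (intro DERIV_isconst_all) auto
  obtain a :: real where "sinc_sqrt n (a\<^sup>2) = 0" using sinc_sqrt_zeros_unbounded by blast
  then have "psi n z = 0" for z using const[of z a] by (simp add: psi_eq)
  then have z: "sinc_sqrt n (z\<^sup>2) = 0" if "z \<noteq> 0" for z :: real
    using that \<open>psi n z = 0\<close> by (simp add: psi_eq)
  have "((\<lambda>z. sinc_sqrt n (z\<^sup>2)) \<longlongrightarrow> sinc_sqrt n (0\<^sup>2)) (at (0::real))"
    by (rule isContD, rule continuous_on_interior[of UNIV]) (auto intro!: continuous_intros)
  then have "((\<lambda>z. 0) \<longlongrightarrow> sinc_sqrt n ((0::real)\<^sup>2)) (at (0::real))"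
    by (rule Lim_transform_eventually) (auto simp: z eventually_at intro!: exI[of _ 1])
  then have "sinc_sqrt n (0::real) = 0" by (simp add: tendsto_const_iff)
  then show False using sinc_sqrt_at_0_nonzero[where 'a = real] by blast
qed

text \<open>The complex \<open>psi_deriv\<close> is entire, extends the real one and is not identically zero.\<close>

lemma psi_deriv_zeros_isolated:
  fixes a :: real
  obtains r where "r > 0" "\<And>x. a < x \<Longrightarrow> x < a + r \<Longrightarrow> psi_deriv n x \<noteq> 0"
proof -
  let ?f = "psi_deriv n :: complex \<Rightarrow> complex"
  have real: "?f (of_real x) = of_real (psi_deriv n x)" for x
    by (simp add: psi_deriv_def flip: sinc_sqrt_of_real)
  have hol: "?f holomorphic_on UNIV"
    unfolding psi_deriv_def[abs_def] holomorphic_on_open[OF open_UNIV]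
    by (auto intro!: exI derivative_eq_intros DERIV_chain2[OF DERIV_sinc_sqrt])
  obtain w where w: "?f w \<noteq> 0"
    using psi_deriv_not_identically_zero[of n] real by (metis of_real_eq_0_iff)
  obtain r where r: "r > 0" "\<And>z. z \<in> ball (of_real a) r - {of_real a} \<Longrightarrow> ?f z \<noteq> 0"
  proof (cases "?f (of_real a) = 0")
    case True
    then show ?thesis
      using isolated_zeros[OF hol open_UNIV connected_UNIV UNIV_I True UNIV_I w] that by metis
  next
    case False
    have "continuous (at (of_real a)) ?f"
      using hol holomorphic_on_imp_continuous_on continuous_on_eq_continuous_at by blast
    then obtain r where "r > 0" "\<And>z. dist (of_real a) z < r \<Longrightarrow> ?f z \<noteq> 0"
      using continuous_at_avoid[of "of_real a" ?f 0] False by metis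
    then show ?thesis using that by auto
  qed
  show thesis
  proof (rule that[OF r(1)])
    fix x assume "a < x" "x < a + r"
    then have "of_real x \<in> ball (complex_of_real a) r - {of_real a}"
      by (auto simp: dist_norm simp flip: of_real_diff)
    then show "psi_deriv n x \<noteq> 0" using r(2) real by fastforce
  qed
qed

text \<open>An open interval to the right of \<open>alpha n m\<close> is free of zeros, so the set whose infimum is taken is
  closed and the infimum is attained.\<close>

lemma alpha_Suc: "alpha n m < alpha n (Suc m)" "psi_deriv n (alpha n (Suc m)) = 0"
proof -
  define a where "a = alpha n m"
  define A where "A = {z. a < z \<and> psi_deriv n z = 0}"
  obtain r where r: "r > 0" "\<And>x. a < x \<Longrightarrow> x < a + r \<Longrightarrow> psi_deriv n x \<noteq> 0"
    using psi_deriv_zeros_isolated by blast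
  have A: "A = {a + r..} \<inter> {z. psi_deriv n z = 0}"
    using r by (force simp: A_def not_less[symmetric])
  have "closed A"
    unfolding A by (intro closed_Int closed_atLeast closed_Collect_eq continuous_psi_deriv continuous_intros)
  moreover have "A \<noteq> {}" using psi_deriv_zeros_unbounded[of a n] by (auto simp: A_def)
  moreover have "bdd_below A" by (auto simp: A_def intro!: bdd_belowI[of _ a])
  ultimately have "Inf A \<in> A" by (intro closed_contains_Inf)
  moreover have "alpha n (Suc m) = Inf A" by (simp add: A_def a_def deriv_psi)
  ultimately show "alpha n m < alpha n (Suc m)" "psi_deriv n (alpha n (Suc m)) = 0"
    by (simp_all add: A_def a_def)
qed

lemma alpha_strict_mono: "strict_mono (alpha n)"
  using alpha_Suc(1) by (simp add: strict_mono_Suc_iff)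

lemma alpha_pos: "m \<ge> 1 \<Longrightarrow> alpha n m > 0"
  using strict_monoD[OF alpha_strict_mono, of 0 m n] by simp

lemma psi_deriv_alpha: "m \<ge> 1 \<Longrightarrow> psi_deriv n (alpha n m) = 0"
  using alpha_Suc(2)[of n "m - 1"] by simp

section \<open>Solid harmonics in Cartesian coordinates\<close>

definition legendre_coeff :: "nat \<Rightarrow> nat \<Rightarrow> nat \<Rightarrow> real" where
  "legendre_coeff n k i = coeff ((pderiv ^^ k) (legendre_poly n)) i"

text \<open>The recursion compares coefficients in \<open>(x\<^sup>2 - 1) u' = 2 n x u\<close> for \<open>u = (x\<^sup>2 - 1)\<^sup>n\<close>.\<close>

lemma coeff_rodrigues_power:
  fixes n :: nat
  defines "u \<equiv> [:-1, 0, 1:] ^ n :: real poly"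
  shows "real (i + 2) * coeff u (i + 2) = (real i - 2 * real n) * coeff u i"
    and "coeff u i = 0 \<longleftrightarrow> odd i \<or> i > 2 * n"
proof -
  have ode: "[:-1, 0, 1:] * pderiv u = smult (2 * real n) ([:0, 1:] * u)"
  proof (cases n)
    case (Suc m)
    have "pderiv u = smult (real n) ([:-1, 0, 1:] ^ m) * [:0, 2:]"
      unfolding u_def Suc pderiv_power_Suc by (simp add: pderiv_pCons)
    then have "[:-1, 0, 1:] * pderiv u = smult (real n) u * [:0, 2:]"
      by (simp add: u_def Suc)
    also have "\<dots> = smult (2 * real n) ([:0, 1:] * u)"
      by simp
    finally show ?thesis .
  qed (simp add: u_def)
  have c: "coeff ([:-1, 0, 1:] * pderiv u) j = coeff (smult (2 * real n) ([:0, 1:] * u)) j" for j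
    by (simp only: ode)
  have rec: "real (i + 2) * coeff u (i + 2) = (real i - 2 * real n) * coeff u i" for i
  proof -
    have "coeff ([:-1, 0, 1:] * p) (Suc i) = (if i = 0 then 0 else coeff p (i - 1)) - coeff p (Suc i)"
      for p :: "real poly" by (cases i) simp_all
    moreover have "coeff ([:0, 1:] * p) (Suc i) = coeff p i" for p :: "real poly" by simp
    ultimately have "(if i = 0 then 0 else coeff (pderiv u) (i - 1)) - coeff (pderiv u) (Suc i) =
        2 * real n * coeff u i"
      using c[of "Suc i"] by (simp only: coeff_smult)
    then show ?thesis by (cases i) (simp_all add: coeff_pderiv left_diff_distrib)
  qed
  then show "real (i + 2) * coeff u (i + 2) = (real i - 2 * real n) * coeff u i" .
  have odd0: "coeff u (2 * l + 1) = 0" for l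
  proof (induction l)
    case 0
    show ?case using c[of 0] by (simp add: coeff_pderiv)
  next
    case (Suc l)
    show ?case using rec[of "2 * l + 1"] Suc by (simp del: of_nat_Suc of_nat_add)
  qed
  then have odd: "coeff u i = 0" if "odd i" for i using that by (auto elim: oddE)
  have deg: "degree u = 2 * n" by (simp add: u_def degree_power_eq)
  have "coeff u (2 * n - 2 * l) \<noteq> 0" if "l \<le> n" for l
    using that
  proof (induction l)
    case 0
    have "u \<noteq> 0" by (simp add: u_def)
    then show ?case using deg by (metis leading_coeff_0_iff diff_zero mult_0_right)
  next
    case (Suc l)
    then show ?case using rec[of "2 * n - 2 * Suc l"]
      by (auto simp: Suc_diff_Suc numeral_2_eq_2)
  qed
  then have "coeff u i \<noteq> 0" if "even i" "i \<le> 2 * n"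
    using that by (elim evenE) (metis diff_diff_cancel diff_le_self diff_mult_distrib2 mult_le_cancel1 zero_less_numeral)
  moreover have "coeff u i = 0" if "i > 2 * n" using that deg by (simp add: coeff_eq_0)
  ultimately show "coeff u i = 0 \<longleftrightarrow> odd i \<or> i > 2 * n" using odd by (meson not_le)
qed

lemma legendre_coeff_eq:
  "legendre_coeff n k i =
    pochhammer (real (Suc i)) (n + k) * coeff ([:-1, 0, 1:] ^ n) (i + n + k) / (2 ^ n * fact n)"
proof -
  have "(pderiv ^^ k) (smult c p) = smult c ((pderiv ^^ k) p)" for c and p :: "real poly"
    by (induction k) (simp_all add: pderiv_smult)
  then have "(pderiv ^^ k) (legendre_poly n) =
      smult (1 / (2 ^ n * fact n)) ((pderiv ^^ (k + n)) ([:-1, 0, 1:] ^ n))"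
    by (simp add: legendre_poly_def funpow_add)
  then show ?thesis
    by (simp add: legendre_coeff_def coeff_higher_pderiv ac_simps del: of_nat_Suc)
qed

lemma legendre_coeff_eq_0_iff: "legendre_coeff n k i = 0 \<longleftrightarrow> odd (i + n + k) \<or> i + k > n"
proof -
  have "pochhammer (real (Suc i)) (n + k) \<noteq> 0"
    by (metis less_numeral_extra(3) of_nat_0_less_iff pochhammer_pos zero_less_Suc)
  then show ?thesis
    using coeff_rodrigues_power(2)[of n "i + n + k"] by (auto simp: legendre_coeff_eq simp del: of_nat_Suc)
qed

text \<open>The coefficient form of
  \<open>(1 - x\<^sup>2) y'' - 2 (k + 1) x y' + (n - k) (n + k + 1) y = 0\<close>, the equation of the \<open>k\<close>-th derivative of
  the Legendre polynomial; it is what makes the solid harmonics harmonic.\<close>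

lemma legendre_coeff_rec:
  "real (i + 2) * real (i + 1) * legendre_coeff n k (i + 2) =
    (real i + real k - real n) * (real i + real k + real n + 1) * legendre_coeff n k i"
proof -
  define N where "N = n + k"
  define u where "u = coeff ([:-1, 0, 1:] ^ n :: real poly)"
  define p where "p = pochhammer (real i + 1) N"
  define q where "q = pochhammer (real i + 3) N"
  have "pochhammer (real i + 1) (Suc (Suc N)) = p * (real i + 1 + real N) * (real i + 2 + real N)"
    by (simp add: pochhammer_Suc p_def add_ac)
  moreover have "pochhammer (real i + 1) (Suc (Suc N)) = (real i + 1) * ((real i + 2) * q)"
    unfolding pochhammer_rec q_def by (simp add: add.assoc)
  ultimately have pq: "(real i + 1) * (real i + 2) * q = p * (real i + 1 + real N) * (real i + 2 + real N)"
    by (simp add: mult_ac)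
  have u: "(real i + real N + 2) * u (i + N + 2) = (real i + real N - 2 * real n) * u (i + N)"
    using coeff_rodrigues_power(1)[of "i + N" n] by (simp add: u_def add_ac)
  have "(real i + 2) * (real i + 1) * (q * u (i + N + 2)) = p * (real i + 1 + real N) * ((real i + real N + 2) * u (i + N + 2))"
    using pq by (simp add: mult_ac add_ac)
  also have "\<dots> = (real i + real N - 2 * real n) * (real i + real N + 1) * (p * u (i + N))"
    unfolding u by (simp add: mult_ac add_ac)
  finally have "(real i + 2) * (real i + 1) * (q * u (i + N + 2)) / (2 ^ n * fact n) =
     (real i + real N - 2 * real n) * (real i + real N + 1) * (p * u (i + N)) / (2 ^ n * fact n)"
    by simp
  then show ?thesis
    by (simp add: legendre_coeff_eq N_def u_def p_def q_def add_ac mult_ac)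
qed

text \<open>The generator of the rotations about the polar axis, \<open>\<partial>/\<partial>\<phi>\<close> in spherical coordinates.\<close>

definition rot :: "real ^ 3 \<Rightarrow> real ^ 3" where
  "rot x = vector [- x $ 2, x $ 1, 0]"

definition xy :: "real ^ 3 \<Rightarrow> complex" where
  "xy x = Complex (x $ 1) (x $ 2)"

text \<open>In spherical coordinates \<open>(r sin \<theta>)\<close> to the power \<open>|k|\<close> times the azimuthal factor of the harmonic.\<close>

definition azimuthal :: "int \<Rightarrow> real ^ 3 \<Rightarrow> real" where
  "azimuthal k x =
     (if k \<ge> 0 then Re else Im) (xy x ^ nat \<bar>k\<bar>)"

definition zonal_monomial :: "nat \<Rightarrow> nat \<Rightarrow> real ^ 3 \<Rightarrow> real" where
  "zonal_monomial i j x = (x $ 3) ^ i * (x \<bullet> x) ^ j"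

text \<open>The polynomial \<open>r\<^sup>n Y\<^sub>n\<^sup>k\<close>: the Legendre factor is made homogeneous with powers of \<open>r\<^sup>2\<close>. Truncation in
  the integer division is harmless, since coefficients of the wrong parity are zero.\<close>

definition solid_harmonic :: "nat \<Rightarrow> int \<Rightarrow> real ^ 3 \<Rightarrow> real" where
  "solid_harmonic n k x = (\<Sum>i\<le>n - nat \<bar>k\<bar>. legendre_coeff n (nat \<bar>k\<bar>) i *
     (zonal_monomial i ((n - nat \<bar>k\<bar> - i) div 2) x * azimuthal k x))"

lemma has_grad_lap_component: "has_grad_lap (\<lambda>x::real^3. x $ i) (\<lambda>_. axis i 1) (\<lambda>_. 0)"
  using has_grad_lap_inner[of "axis i (1::real)"] by (simp add: inner_axis)

lemma has_grad_lap_cong: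
  assumes "has_grad_lap f G l" "\<And>x. f x = f' x" "\<And>x. G x = G' x" "\<And>x. l x = l' x"
  shows "has_grad_lap f' G' l'"
proof -
  have "f = f'" "G = G'" "l = l'" using assms(2-4) by auto
  then show ?thesis using assms(1) by simp
qed

text \<open>Real and imaginary part need a joint induction, since each occurs in the derivative of the other.\<close>

lemma has_grad_lap_complex_power:
  "has_grad_lap (\<lambda>x. Re (xy x ^ k))
      (\<lambda>x. vector [real k * Re (xy x ^ (k - 1)), - real k * Im (xy x ^ (k - 1)), 0]) (\<lambda>_. 0) \<and>
    has_grad_lap (\<lambda>x. Im (xy x ^ k))
      (\<lambda>x. vector [real k * Im (xy x ^ (k - 1)), real k * Re (xy x ^ (k - 1)), 0]) (\<lambda>_. 0)"
proof (induction k)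
  case 0
  have [simp]: "vector [0, 0, 0] = (0::real^3)" by (simp add: vec_eq_iff forall_3)
  show ?case by (simp add: has_grad_lap_const)
next
  case (Suc k)
  let ?k = "real k"
  let ?G = "\<lambda>x. vector [?k * Re (xy x ^ (k - 1)), - ?k * Im (xy x ^ (k - 1)), 0] :: real ^ 3"
  let ?H = "\<lambda>x. vector [?k * Im (xy x ^ (k - 1)), ?k * Re (xy x ^ (k - 1)), 0] :: real ^ 3"
  have Re1: "x $ 1 * (?k * Re (xy x ^ (k - 1))) - x $ 2 * (?k * Im (xy x ^ (k - 1))) = ?k * Re (xy x ^ k)"
    and Im1: "x $ 1 * (?k * Im (xy x ^ (k - 1))) + x $ 2 * (?k * Re (xy x ^ (k - 1))) = ?k * Im (xy x ^ k)" for x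
    by (cases k; simp add: xy_def algebra_simps)+
  have ax: "axis i 1 \<bullet> v = v $ i" for i and v :: "real ^ 3"
    by (simp add: inner_commute[of _ v] inner_axis)
  show ?case
  proof
    show "has_grad_lap (\<lambda>x. Re (xy x ^ Suc k))
      (\<lambda>x. vector [real (Suc k) * Re (xy x ^ (Suc k - 1)), - real (Suc k) * Im (xy x ^ (Suc k - 1)), 0]) (\<lambda>_. 0)"
    proof (rule has_grad_lap_cong)
      show "has_grad_lap (\<lambda>x. x $ 1 * Re (xy x ^ k) - x $ 2 * Im (xy x ^ k))
        (\<lambda>x. (x $ 1 *\<^sub>R ?G x + Re (xy x ^ k) *\<^sub>R axis 1 1) - (x $ 2 *\<^sub>R ?H x + Im (xy x ^ k) *\<^sub>R axis 2 1))
        (\<lambda>x. (x $ 1 * 0 + 2 * (axis 1 1 \<bullet> ?G x) + Re (xy x ^ k) * 0)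
          - (x $ 2 * 0 + 2 * (axis 2 1 \<bullet> ?H x) + Im (xy x ^ k) * 0))"
        using Suc by (intro has_grad_lap_diff has_grad_lap_mult has_grad_lap_component) auto
      show "(x $ 1 *\<^sub>R ?G x + Re (xy x ^ k) *\<^sub>R axis 1 1) - (x $ 2 *\<^sub>R ?H x + Im (xy x ^ k) *\<^sub>R axis 2 1)
        = vector [real (Suc k) * Re (xy x ^ (Suc k - 1)), - real (Suc k) * Im (xy x ^ (Suc k - 1)), 0]" for x
        using Re1[of x] Im1[of x] by (simp add: vec_eq_iff forall_3 axis_def distrib_right left_diff_distrib)
    qed (simp_all add: xy_def ax)
    show "has_grad_lap (\<lambda>x. Im (xy x ^ Suc k))
      (\<lambda>x. vector [real (Suc k) * Im (xy x ^ (Suc k - 1)), real (Suc k) * Re (xy x ^ (Suc k - 1)), 0]) (\<lambda>_. 0)"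
    proof (rule has_grad_lap_cong)
      show "has_grad_lap (\<lambda>x. x $ 1 * Im (xy x ^ k) + x $ 2 * Re (xy x ^ k))
        (\<lambda>x. (x $ 1 *\<^sub>R ?H x + Im (xy x ^ k) *\<^sub>R axis 1 1) + (x $ 2 *\<^sub>R ?G x + Re (xy x ^ k) *\<^sub>R axis 2 1))
        (\<lambda>x. (x $ 1 * 0 + 2 * (axis 1 1 \<bullet> ?H x) + Im (xy x ^ k) * 0)
          + (x $ 2 * 0 + 2 * (axis 2 1 \<bullet> ?G x) + Re (xy x ^ k) * 0))"
        using Suc by (intro has_grad_lap_add has_grad_lap_mult has_grad_lap_component) auto
      show "(x $ 1 *\<^sub>R ?H x + Im (xy x ^ k) *\<^sub>R axis 1 1) + (x $ 2 *\<^sub>R ?G x + Re (xy x ^ k) *\<^sub>R axis 2 1)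
        = vector [real (Suc k) * Im (xy x ^ (Suc k - 1)), real (Suc k) * Re (xy x ^ (Suc k - 1)), 0]" for x
        using Re1[of x] Im1[of x] by (simp add: vec_eq_iff forall_3 axis_def distrib_right left_diff_distrib)
    qed (simp_all add: xy_def ax)
  qed
qed

lemma azimuthal_gradient:
  obtains G where "has_grad_lap (azimuthal k) G (\<lambda>_. 0)"
    "\<And>x. x \<bullet> G x = of_int \<bar>k\<bar> * azimuthal k x" "\<And>x. G x $ 3 = 0"
    "\<And>x. rot x \<bullet> G x = - of_int k * azimuthal (- k) x"
proof -
  define m where "m = nat \<bar>k\<bar>"
  have m: "real m = of_int \<bar>k\<bar>" by (simp add: m_def)
  have Re1: "x $ 1 * (real m * Re (xy x ^ (m - 1))) - x $ 2 * (real m * Im (xy x ^ (m - 1))) = real m * Re (xy x ^ m)"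
    and Im1: "x $ 1 * (real m * Im (xy x ^ (m - 1))) + x $ 2 * (real m * Re (xy x ^ (m - 1))) = real m * Im (xy x ^ m)" for x
    by (cases m; simp add: xy_def algebra_simps)+
  note H = has_grad_lap_complex_power[of m]
  show thesis
  proof (cases "k \<ge> 0")
    case True
    have a: "azimuthal k = (\<lambda>x. Re (xy x ^ m))" using True by (simp add: fun_eq_iff azimuthal_def m_def)
    have a': "real m * azimuthal (- k) x = real m * Im (xy x ^ m)" for x
      using True by (cases "k = 0") (auto simp: azimuthal_def m_def)
    show thesis
    proof (rule that)
      show "has_grad_lap (azimuthal k)
        (\<lambda>x. vector [real m * Re (xy x ^ (m - 1)), - real m * Im (xy x ^ (m - 1)), 0]) (\<lambda>_. 0)"
        using H a by simp
      show "x \<bullet> vector [real m * Re (xy x ^ (m - 1)), - real m * Im (xy x ^ (m - 1)), 0] =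
          of_int \<bar>k\<bar> * azimuthal k x" for x
        using Re1[of x] by (simp add: a inner_vec_def sum_3 m)
      have "- real_of_int k * azimuthal (- k) x = - (real m * Im (xy x ^ m))" for x
        using True a'[of x] by (simp add: m)
      then show "rot x \<bullet> vector [real m * Re (xy x ^ (m - 1)), - real m * Im (xy x ^ (m - 1)), 0] =
          - of_int k * azimuthal (- k) x" for x
        using Im1[of x] by (simp add: inner_vec_def sum_3 rot_def)
    qed simp
  next
    case False
    have a: "azimuthal k = (\<lambda>x. Im (xy x ^ m))" using False by (simp add: fun_eq_iff azimuthal_def m_def)
    have a': "azimuthal (- k) x = Re (xy x ^ m)" for x
      using False by (auto simp: azimuthal_def m_def)
    show thesis
    proof (rule that)
      show "has_grad_lap (azimuthal k)
        (\<lambda>x. vector [real m * Im (xy x ^ (m - 1)), real m * Re (xy x ^ (m - 1)), 0]) (\<lambda>_. 0)"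
        using H a by simp
      show "x \<bullet> vector [real m * Im (xy x ^ (m - 1)), real m * Re (xy x ^ (m - 1)), 0] =
          of_int \<bar>k\<bar> * azimuthal k x" for x
        using Im1[of x] by (simp add: a inner_vec_def sum_3 m)
      have "- real_of_int k * azimuthal (- k) x = real m * Re (xy x ^ m)" for x
        using False a'[of x] by (simp add: m)
      then show "rot x \<bullet> vector [real m * Im (xy x ^ (m - 1)), real m * Re (xy x ^ (m - 1)), 0] =
          - of_int k * azimuthal (- k) x" for x
        using Re1[of x] by (simp add: inner_vec_def sum_3 rot_def)
    qed simp
  qed
qed

lemma rot_position: "rot x \<bullet> x = 0"
  by (simp add: rot_def inner_vec_def sum_3)

lemma power_minus_two:
  "real i * real (i - 1) * t ^ (i - 2) * t = real i * real (i - 1) * t ^ (i - 1)"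
  by (cases i rule: nat.exhaust; cases "i - 1"; simp)

lemma zonal_monomial_gradient:
  fixes i j :: nat
  defines "G \<equiv> \<lambda>x::real^3. (real i * x $ 3 ^ (i - 1) * (x \<bullet> x) ^ j) *\<^sub>R axis 3 1
    + (2 * real j * x $ 3 ^ i * (x \<bullet> x) ^ (j - 1)) *\<^sub>R x"
  shows "has_grad_lap (zonal_monomial i j) G
    (\<lambda>x. real i * real (i - 1) * x $ 3 ^ (i - 2) * (x \<bullet> x) ^ j +
      2 * real j * (2 * real i + 2 * real j + 1) * x $ 3 ^ i * (x \<bullet> x) ^ (j - 1))"
proof (rule has_grad_lap_cong)
  let ?P = "\<lambda>x::real^3. (real i * (x $ 3) ^ (i - 1)) *\<^sub>R axis 3 1"
  let ?Q = "\<lambda>x::real^3. (real j * (x \<bullet> x) ^ (j - 1)) *\<^sub>R (2 *\<^sub>R x)"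
  let ?k = "\<lambda>x::real^3. real i * (real (i - 1) * (x $ 3) ^ (i - 2)) * (axis 3 1 \<bullet> (axis 3 1 :: real^3)) + real i * (x $ 3) ^ (i - 1) * 0"
  let ?l = "\<lambda>x::real^3. real j * (real (j - 1) * (x \<bullet> x) ^ (j - 2)) * ((2 *\<^sub>R x) \<bullet> (2 *\<^sub>R x)) + real j * (x \<bullet> x) ^ (j - 1) * (2 * real DIM(real^3))"
  show "has_grad_lap (\<lambda>x. (x $ 3) ^ i * (x \<bullet> x) ^ j)
      (\<lambda>x. (x $ 3) ^ i *\<^sub>R ?Q x + (x \<bullet> x) ^ j *\<^sub>R ?P x)
      (\<lambda>x. (x $ 3) ^ i * ?l x + 2 * (?P x \<bullet> ?Q x) + (x \<bullet> x) ^ j * ?k x)"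
    by (intro has_grad_lap_mult has_grad_lap_power[OF has_grad_lap_square]
        has_grad_lap_power[OF has_grad_lap_component])
  fix x :: "real ^ 3"
  define s t where "s = x \<bullet> x" and "t = x $ 3"
  have [simp]: "axis 3 1 \<bullet> x = t" by (simp add: inner_commute[of _ x] inner_axis t_def)
  have t: "real i * t ^ (i - 1) * t = real i * t ^ i" by (cases i) auto
  have s: "real j * real (j - 1) * s ^ (j - 2) * s = real j * (real j - 1) * s ^ (j - 1)"
    using power_minus_two[of j s] by (cases j) auto
  have "(x $ 3) ^ i * ?l x + 2 * (?P x \<bullet> ?Q x) + (x \<bullet> x) ^ j * ?k x =
      t ^ i * (4 * (real j * real (j - 1) * s ^ (j - 2) * s) + 6 * real j * s ^ (j - 1))
      + 4 * real j * s ^ (j - 1) * (real i * t ^ (i - 1) * t) + s ^ j * (real i * real (i - 1) * t ^ (i - 2))"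
    by (simp flip: s_def t_def add: inner_axis algebra_simps)
  also have "\<dots> = t ^ i * (4 * (real j * (real j - 1) * s ^ (j - 1)) + 6 * real j * s ^ (j - 1))
      + 4 * real j * s ^ (j - 1) * (real i * t ^ i) + s ^ j * (real i * real (i - 1) * t ^ (i - 2))"
    by (simp only: s t)
  also have "\<dots> = real i * real (i - 1) * x $ 3 ^ (i - 2) * (x \<bullet> x) ^ j +
      2 * real j * (2 * real i + 2 * real j + 1) * x $ 3 ^ i * (x \<bullet> x) ^ (j - 1)"
    by (simp add: s_def t_def algebra_simps)
  finally show "(x $ 3) ^ i * ?l x + 2 * (?P x \<bullet> ?Q x) + (x \<bullet> x) ^ j * ?k x =
      real i * real (i - 1) * x $ 3 ^ (i - 2) * (x \<bullet> x) ^ j +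
      2 * real j * (2 * real i + 2 * real j + 1) * x $ 3 ^ i * (x \<bullet> x) ^ (j - 1)" .
qed (simp_all add: zonal_monomial_def G_def mult_ac)

text \<open>In the Laplacian of the sum over \<open>i\<close>, the term from differentiating the power of \<open>x $ 3\<close> twice at
  index \<open>i + 2\<close> cancels the remaining terms at index \<open>i\<close>; this is the recursion of the Legendre
  coefficients. For the rotation, only the azimuthal factor depends on \<open>\<phi>\<close>, and \<open>\<partial>/\<partial>\<phi>\<close> exchanges cosine
  and sine, that is, \<open>k\<close> and \<open>- k\<close>.\<close>

lemma
  assumes k: "\<bar>k\<bar> \<le> int n"
  defines "D \<equiv> grad (solid_harmonic n k)"
  shows solid_harmonic_laplace: "has_grad_lap (solid_harmonic n k) D (\<lambda>_. 0)"
    and solid_harmonic_euler: "x \<bullet> D x = real n * solid_harmonic n k x"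
    and solid_harmonic_rot: "rot x \<bullet> D x = - of_int k * solid_harmonic n (- k) x"
proof -
  define m d where "m = nat \<bar>k\<bar>" and "d = n - nat \<bar>k\<bar>"
  define a where "a = legendre_coeff n m"
  define j where "j = (\<lambda>i. (d - i) div 2)"
  have d: "n = d + m" using k by (simp add: d_def m_def)
  have rec: "real (i + 2) * real (i + 1) * a (i + 2) =
      (real i + real m - real n) * (real i + real m + real n + 1) * a i" for i
    unfolding a_def by (rule legendre_coeff_rec)
  have j: "2 * real (j i) = real d - real i" if "i \<le> d" "a i \<noteq> 0" for i
  proof -
    have "even (d - i)" using that by (auto simp: a_def legendre_coeff_eq_0_iff d)
    then have "2 * j i = d - i" by (simp add: j_def)
    then show ?thesis using that by linarith
  qed
  have solid: "solid_harmonic n l x = (\<Sum>i\<le>d. a i * (zonal_monomial i (j i) x * azimuthal l x))"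
    if "\<bar>l\<bar> = \<bar>k\<bar>" for l x
    by (simp add: solid_harmonic_def a_def j_def d_def m_def that)
  obtain C where C: "has_grad_lap (azimuthal k) C (\<lambda>_. 0)"
    "\<And>x. x \<bullet> C x = of_int \<bar>k\<bar> * azimuthal k x" "\<And>x. C x $ 3 = 0"
    "\<And>x. rot x \<bullet> C x = - of_int k * azimuthal (- k) x"
    using azimuthal_gradient by blast
  have ax: "axis i 1 \<bullet> v = v $ i" for i and v :: "real ^ 3"
    by (simp add: inner_commute[of _ v] inner_axis)
  define M where "M = (\<lambda>i x::real^3. (real i * x $ 3 ^ (i - 1) * (x \<bullet> x) ^ j i) *\<^sub>R axis 3 1
    + (2 * real (j i) * x $ 3 ^ i * (x \<bullet> x) ^ (j i - 1)) *\<^sub>R x)"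
  define f where "f = (\<lambda>x::real^3. \<lambda>i. a i * (real i * real (i - 1)) * x $ 3 ^ (i - 2) * (x \<bullet> x) ^ j i)"
  define h where "h = (\<lambda>x::real^3. \<lambda>i. a i * (2 * real (j i) * (2 * real i + 2 * real (j i) + 1 + 2 * real m))
    * x $ 3 ^ i * (x \<bullet> x) ^ (j i - 1))"
  define G where "G = (\<lambda>x. \<Sum>i\<le>d. a i *\<^sub>R (zonal_monomial i (j i) x *\<^sub>R C x + azimuthal k x *\<^sub>R M i x))"
  have xM: "x \<bullet> M i x = (real i + 2 * real (j i)) * zonal_monomial i (j i) x" for i x
    unfolding M_def zonal_monomial_def inner_add_right
    by (cases i; cases "j i"; simp add: inner_axis algebra_simps)
  have rotM: "rot x \<bullet> M i x = 0" for i x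
  proof -
    have "rot x \<bullet> axis 3 1 = 0" by (simp add: inner_axis rot_def)
    then show ?thesis by (simp add: M_def inner_add_right rot_position)
  qed
  have CM: "M i x \<bullet> C x = (2 * real (j i) * x $ 3 ^ i * (x \<bullet> x) ^ (j i - 1)) * (real m * azimuthal k x)" for i x
    by (simp add: M_def inner_add_left ax C m_def)
  have "has_grad_lap (solid_harmonic n k) G (\<lambda>x. \<Sum>i\<le>d. a i * (zonal_monomial i (j i) x * 0 + 2 * (M i x \<bullet> C x) + azimuthal k x *
      (real i * real (i - 1) * x $ 3 ^ (i - 2) * (x \<bullet> x) ^ j i +
      2 * real (j i) * (2 * real i + 2 * real (j i) + 1) * x $ 3 ^ i * (x \<bullet> x) ^ (j i - 1))))"
    unfolding solid[OF refl, abs_def] G_def M_def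
    by (intro has_grad_lap_sum has_grad_lap_cmult has_grad_lap_mult zonal_monomial_gradient C)
  moreover have "(\<Sum>i\<le>d. a i * (zonal_monomial i (j i) x * 0 + 2 * (M i x \<bullet> C x) + azimuthal k x *
      (real i * real (i - 1) * x $ 3 ^ (i - 2) * (x \<bullet> x) ^ j i +
      2 * real (j i) * (2 * real i + 2 * real (j i) + 1) * x $ 3 ^ i * (x \<bullet> x) ^ (j i - 1)))) = 0" for x
  proof -
    have step: "f x (i + 2) = - h x i" if "i \<le> d" for i
    proof -
      have "j (i + 2) = j i - 1" by (simp add: j_def)
      then have "f x (i + 2) = (real (i + 2) * real (i + 1) * a (i + 2)) * (x $ 3 ^ i * (x \<bullet> x) ^ (j i - 1))"
        by (simp add: f_def)
      also have "real (i + 2) * real (i + 1) * a (i + 2) =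
          - (a i * (2 * real (j i) * (2 * real i + 2 * real (j i) + 1 + 2 * real m)))"
      proof (cases "a i = 0")
        case False
        then have n: "real n = real i + 2 * real (j i) + real m" using j[OF that] by (simp add: d)
        show ?thesis unfolding rec n by (simp add: algebra_simps)
      next
        case True
        then show ?thesis unfolding rec by simp
      qed
      finally show ?thesis by (simp add: h_def)
    qed
    have "(\<Sum>i\<le>d. f x i) = (\<Sum>i\<le>d + 2. f x i)"
      by (rule sum.mono_neutral_left) (auto simp: f_def a_def legendre_coeff_eq_0_iff d)
    also have "\<dots> = f x 0 + f x 1 + (\<Sum>i\<le>d. f x (i + 2))"
      by (simp add: numeral_2_eq_2 sum.atMost_Suc_shift del: sum.atMost_Suc)
    also have "\<dots> = - (\<Sum>i\<le>d. h x i)"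
      using step by (simp add: f_def sum_negf)
    finally have "azimuthal k x * ((\<Sum>i\<le>d. f x i) + (\<Sum>i\<le>d. h x i)) = 0" by simp
    moreover have "azimuthal k x * (f x i + h x i) = a i * (zonal_monomial i (j i) x * 0 + 2 * (M i x \<bullet> C x) + azimuthal k x *
      (real i * real (i - 1) * x $ 3 ^ (i - 2) * (x \<bullet> x) ^ j i +
      2 * real (j i) * (2 * real i + 2 * real (j i) + 1) * x $ 3 ^ i * (x \<bullet> x) ^ (j i - 1)))" for i
      unfolding CM f_def h_def by (simp add: algebra_simps)
    ultimately show ?thesis by (simp only: sum.distrib[symmetric] sum_distrib_left)
  qed
  ultimately have lap: "has_grad_lap (solid_harmonic n k) G (\<lambda>_. 0)" by simp
  have euler: "x \<bullet> G x = real n * solid_harmonic n k x" for x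
  proof -
    have "a i * (x \<bullet> (zonal_monomial i (j i) x *\<^sub>R C x + azimuthal k x *\<^sub>R M i x)) =
        real n * (a i * (zonal_monomial i (j i) x * azimuthal k x))" if "i \<le> d" for i
    proof (cases "a i = 0")
      case False
      have "x \<bullet> (zonal_monomial i (j i) x *\<^sub>R C x + azimuthal k x *\<^sub>R M i x) =
          (real m + (real i + 2 * real (j i))) * (zonal_monomial i (j i) x * azimuthal k x)"
        by (simp add: inner_add_right C xM m_def algebra_simps)
      also have "real m + (real i + 2 * real (j i)) = real n" using j[OF that False] by (simp add: d)
      finally show ?thesis by simp
    qed simp
    note step = this
    show ?thesis
      unfolding G_def solid[OF refl] inner_sum_right sum_distrib_left inner_scaleR_right
      by (intro sum.cong refl step) simp
  qed
  have "rot x \<bullet> G x = - of_int k * solid_harmonic n (- k) x" for x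
    by (simp add: G_def solid inner_sum_right inner_add_right rotM C sum_distrib_left mult_ac sum_negf)
  moreover have "D = G"
    using lap has_gradient_imp_grad unfolding D_def has_grad_lap_def by blast
  ultimately show "has_grad_lap (solid_harmonic n k) D (\<lambda>_. 0)"
    "x \<bullet> D x = real n * solid_harmonic n k x"
    "rot x \<bullet> D x = - of_int k * solid_harmonic n (- k) x"
    using lap euler by simp_all
qed

section \<open>Spherical coordinates\<close>

lemma legendre_coeff_sum:
  assumes "k \<le> n"
  shows "(\<Sum>i\<le>n - k. legendre_coeff n k i * x ^ i) = poly ((pderiv ^^ k) (legendre_poly n)) x"
proof -
  let ?p = "(pderiv ^^ k) (legendre_poly n)"
  have "coeff ?p i = 0" if "i > n - k" for i
  proof -
    have "i + k > n" using that by arith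
    then show ?thesis using legendre_coeff_eq_0_iff[of n k i] by (simp add: legendre_coeff_def)
  qed
  then have "degree ?p \<le> n - k" by (intro degree_le) auto
  then have "(\<Sum>i\<le>degree ?p. coeff ?p i * x ^ i) = (\<Sum>i\<le>n - k. coeff ?p i * x ^ i)"
    by (intro sum.mono_neutral_left) (auto simp: coeff_eq_0)
  then show ?thesis by (simp add: poly_altdef legendre_coeff_def)
qed

lemma e_r_square: "e_r \<theta> \<phi> \<bullet> e_r \<theta> \<phi> = 1"
proof -
  have "(sin \<theta> * cos \<phi>)\<^sup>2 + (sin \<theta> * sin \<phi>)\<^sup>2 + (cos \<theta>)\<^sup>2 =
      (sin \<theta>)\<^sup>2 * ((sin \<phi>)\<^sup>2 + (cos \<phi>)\<^sup>2) + (cos \<theta>)\<^sup>2"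
    by (simp only: power_mult_distrib) algebra
  also have "\<dots> = 1" by simp
  finally show ?thesis by (simp add: e_r_def inner_vec_def sum_3 power2_eq_square)
qed

lemma azimuthal_spherical:
  "azimuthal k (r *\<^sub>R e_r \<theta> \<phi>) = (r * sin \<theta>) ^ nat \<bar>k\<bar> *
     (if k \<ge> 0 then cos (of_int k * \<phi>) else sin (of_int \<bar>k\<bar> * \<phi>))"
proof -
  have "xy (r *\<^sub>R e_r \<theta> \<phi>) = of_real (r * sin \<theta>) * cis \<phi>"
    by (simp add: xy_def e_r_def complex_eq_iff)
  then have "xy (r *\<^sub>R e_r \<theta> \<phi>) ^ nat \<bar>k\<bar> = of_real ((r * sin \<theta>) ^ nat \<bar>k\<bar>) * cis (real (nat \<bar>k\<bar>) * \<phi>)"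
    by (simp add: power_mult_distrib Complex.DeMoivre)
  then show ?thesis by (simp add: azimuthal_def)
qed

lemma solid_harmonic_spherical:
  assumes k: "\<bar>k\<bar> \<le> int n" and \<theta>: "0 \<le> \<theta>" "\<theta> \<le> pi"
  shows "solid_harmonic n k (r *\<^sub>R e_r \<theta> \<phi>) = r ^ n * sph_harm n k \<theta> \<phi>"
proof -
  define m where "m = nat \<bar>k\<bar>"
  define d where "d = n - m"
  have m: "m \<le> n" and d: "n = d + m" using k by (simp_all add: d_def m_def)
  let ?x = "r *\<^sub>R e_r \<theta> \<phi>"
  have x: "?x $ 3 = r * cos \<theta>" "?x \<bullet> ?x = r\<^sup>2"
    by (simp_all add: e_r_square power2_eq_square) (simp add: e_r_def)
  have s: "sqrt (1 - (cos \<theta>)\<^sup>2) = sin \<theta>"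
    using sin_ge_zero[OF \<theta>] by (simp flip: sin_squared_eq)
  have "legendre_coeff n m i * (zonal_monomial i ((d - i) div 2) ?x * A) =
      r ^ d * A * (legendre_coeff n m i * cos \<theta> ^ i)" if "i \<le> d" for i A
  proof (cases "legendre_coeff n m i = 0")
    case False
    then have "even (d - i)" using that by (auto simp: legendre_coeff_eq_0_iff d)
    then have "r ^ i * (r\<^sup>2) ^ ((d - i) div 2) = r ^ d"
      using that by (simp flip: power_mult power_add)
    then have "zonal_monomial i ((d - i) div 2) ?x = r ^ d * cos \<theta> ^ i"
      by (simp only: zonal_monomial_def x power_mult_distrib) (simp add: mult_ac)
    then show ?thesis by simp
  qed simp
  note summand = this
  have "solid_harmonic n k ?x = (\<Sum>i\<le>d. r ^ d * azimuthal k ?x * (legendre_coeff n m i * cos \<theta> ^ i))"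
    unfolding solid_harmonic_def m_def[symmetric] d_def[symmetric]
    by (intro sum.cong refl summand) simp
  also have "\<dots> = r ^ d * azimuthal k ?x * poly ((pderiv ^^ m) (legendre_poly n)) (cos \<theta>)"
    using legendre_coeff_sum[OF m, of "cos \<theta>"] by (simp add: d flip: sum_distrib_left)
  also have "\<dots> = r ^ n * sph_harm n k \<theta> \<phi>"
    unfolding azimuthal_spherical sph_harm_def assoc_legendre_def s m_def[symmetric]
    by (simp add: d power_add power_mult_distrib)
  finally show ?thesis .
qed

text \<open>On the polar axis and at the origin the values of \<open>Arg\<close> at zero and of division by zero are multiplied
  by zero, so the identity needs no exception.\<close>

lemma spherical_coordinates:
  "x = norm x *\<^sub>R e_r (polar_angle x) (azimuth x)" "0 \<le> polar_angle x" "polar_angle x \<le> pi"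
proof -
  define r t z where "r = norm x" and "t = x $ 3 / norm x" and "z = Complex (x $ 1) (x $ 2)"
  have r: "r\<^sup>2 = (x $ 1)\<^sup>2 + (x $ 2)\<^sup>2 + (x $ 3)\<^sup>2"
    by (simp only: r_def power2_norm_eq_inner) (simp add: inner_vec_def sum_3 power2_eq_square)
  have "\<bar>x $ 3\<bar> \<le> norm x" by (rule component_le_norm_cart)
  then have t: "-1 \<le> t" "t \<le> 1" by (auto simp: t_def divide_simps)
  then show "0 \<le> polar_angle x" "polar_angle x \<le> pi"
    by (simp_all add: polar_angle_def arccos_lbound arccos_ubound flip: t_def)
  have ct: "r * cos (polar_angle x) = x $ 3"
    using t by (cases "x = 0") (simp_all add: polar_angle_def r_def flip: t_def, simp add: t_def)
  have "0 \<le> r * sin (polar_angle x)"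
    using t by (simp add: r_def polar_angle_def sin_ge_zero arccos_lbound arccos_ubound flip: t_def)
  moreover have "(r * sin (polar_angle x))\<^sup>2 = r\<^sup>2 - (r * cos (polar_angle x))\<^sup>2"
    by (simp add: power_mult_distrib sin_squared_eq algebra_simps)
  then have "(r * sin (polar_angle x))\<^sup>2 = (cmod z)\<^sup>2"
    by (simp add: ct r z_def cmod_power2)
  ultimately have st: "r * sin (polar_angle x) = cmod z"
    by (simp add: power2_eq_iff_nonneg)
  have "of_real (cmod z) * cis (Arg z) = z"
    by (cases "z = 0") (simp_all add: cis_Arg complex_sgn_def sgn_div_norm scaleR_conv_of_real)
  then have "cmod z * cos (Arg z) = x $ 1" "cmod z * sin (Arg z) = x $ 2"
    by (auto simp: z_def complex_eq_iff)
  then have "r * (sin (polar_angle x) * cos (azimuth x)) = x $ 1"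
    "r * (sin (polar_angle x) * sin (azimuth x)) = x $ 2"
    using st by (simp_all add: azimuth_def flip: z_def mult.assoc)
  then show "x = norm x *\<^sub>R e_r (polar_angle x) (azimuth x)"
    using ct by (simp add: vec_eq_iff forall_3 e_r_def r_def)
qed

lemma sph_harm_nonzero:
  assumes k: "\<bar>k\<bar> \<le> int n"
  obtains \<theta> \<phi> where "0 \<le> \<theta>" "\<theta> \<le> pi" "sph_harm n k \<theta> \<phi> \<noteq> 0"
proof -
  define m where "m = nat \<bar>k\<bar>"
  let ?p = "(pderiv ^^ m) (legendre_poly n)"
  have "m \<le> n" using k by (simp add: m_def)
  then have "legendre_coeff n m (n - m) \<noteq> 0" by (simp add: legendre_coeff_eq_0_iff)
  then have "?p \<noteq> 0" by (auto simp: legendre_coeff_def)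
  then have "finite {x. poly ?p x = 0}" by (rule poly_roots_finite)
  moreover have "infinite {-1<..<(1::real)}" by simp
  ultimately have "\<not> {-1<..<1} \<subseteq> {x. poly ?p x = 0}" using finite_subset by blast
  then obtain x where "x \<in> {-1<..<1}" "x \<notin> {x. poly ?p x = 0}" by blast
  then have x: "-1 < x" "x < 1" "poly ?p x \<noteq> 0" by simp_all
  have "x\<^sup>2 < 1" using x by (simp add: abs_square_less_1)
  then have a: "assoc_legendre n m x \<noteq> 0" using x by (simp add: assoc_legendre_def)
  define \<phi> where "\<phi> = (if k \<ge> 0 then 0 else pi / (2 * of_int \<bar>k\<bar>))"
  have "(if k \<ge> 0 then cos (of_int k * \<phi>) else sin (of_int \<bar>k\<bar> * \<phi>)) = 1"
    by (auto simp: \<phi>_def)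
  then have "sph_harm n k (arccos x) \<phi> \<noteq> 0"
    using a x by (simp add: sph_harm_def flip: m_def)
  then show thesis using that[of "arccos x" \<phi>] x by (simp add: arccos_lbound arccos_ubound)
qed

section \<open>Integrals over the ball\<close>

definition ball_integral :: "real \<Rightarrow> (real ^ 3 \<Rightarrow> real) \<Rightarrow> real" where
  "ball_integral R f = (LINT x|lborel. indicator (ball 0 R) x * f x)"

lemma ball_integral_add:
  assumes "continuous_on UNIV f" "continuous_on UNIV g"
  shows "ball_integral R (\<lambda>x. f x + g x) = ball_integral R f + ball_integral R g"
  using integrable_on_ball[OF assms(1), of R] integrable_on_ball[OF assms(2), of R]
  by (simp add: ball_integral_def distrib_left)

lemma ball_integral_cmult: "ball_integral R (\<lambda>x. c * f x) = c * ball_integral R f"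
  by (simp add: ball_integral_def mult.left_commute[of _ c])

lemma L2_inner_eq_ball_integral:
  fixes f g :: "real ^ 3 \<Rightarrow> 'b::euclidean_space"
  assumes "continuous_on UNIV f" "continuous_on UNIV g"
  shows "L2_inner (ball 0 R) f g = ball_integral R (\<lambda>x. f x \<bullet> g x)"
proof -
  have "continuous_on UNIV (\<lambda>x. f x \<bullet> g x)" using assms by (intro continuous_intros)
  then have meas: "(\<lambda>x. f x \<bullet> g x) \<in> borel_measurable borel"
    by (rule borel_measurable_continuous_onI)
  have "L2_inner (ball 0 R) f g = (LINT x|lebesgue. indicator (ball 0 R) x *\<^sub>R (f x \<bullet> g x))"
    unfolding L2_inner_def by (rule integral_restrict_space) simp
  also have "\<dots> = (LINT x|lborel. indicator (ball 0 R) x *\<^sub>R (f x \<bullet> g x))"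
    by (rule integral_completion) (auto intro!: borel_measurable_times borel_measurable_indicator meas)
  finally show ?thesis by (simp add: ball_integral_def)
qed

lemma continuous_imp_L2:
  fixes f :: "real ^ 3 \<Rightarrow> 'b::euclidean_space"
  assumes f: "continuous_on UNIV f"
  shows "f \<in> L2 (ball 0 R)"
proof -
  have [measurable]: "f \<in> borel_measurable borel" using f by (rule borel_measurable_continuous_onI)
  have "continuous_on UNIV (\<lambda>x. (norm (f x))\<^sup>2)" using f by (intro continuous_intros)
  then have "integrable lborel (\<lambda>x. indicator (ball 0 R) x * (norm (f x))\<^sup>2)"
    by (rule integrable_on_ball)
  then have "integrable lebesgue (\<lambda>x. indicator (ball 0 R) x *\<^sub>R (norm (f x))\<^sup>2)"
    by (subst integrable_completion) (auto intro!: borel_measurable_scaleR borel_measurable_indicator)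
  then have "integrable (lebesgue_on (ball 0 R)) (\<lambda>x. (norm (f x))\<^sup>2)"
    by (subst integrable_restrict_space) auto
  moreover have "f \<in> borel_measurable (lebesgue_on (ball 0 R))"
    using \<open>f \<in> borel_measurable borel\<close> by (intro measurable_restrict_space1 measurable_completion) simp
  ultimately show ?thesis by (simp add: L2_def)
qed

lemma has_gradient_radial:
  assumes "\<And>t. (\<phi> has_field_derivative \<phi>' t) (at t)" "continuous_on UNIV \<phi>'"
  shows "has_gradient (\<lambda>x::'a::euclidean_space. \<phi> (x \<bullet> x)) (\<lambda>x. (2 * \<phi>' (x \<bullet> x)) *\<^sub>R x)"
  using has_gradient_compose[OF has_gradient_square assms] by (simp add: mult.commute)

text \<open>With \<open>w' = f\<close> and \<open>w(R\<^sup>2) = 0\<close>, the field \<open>w(|x|\<^sup>2) (P \<nabla>Q - Q \<nabla>P)\<close> vanishes on the sphere. By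
  harmonicity and Euler's identity its divergence is \<open>2 (n' - n) f(|x|\<^sup>2) P Q\<close>.\<close>

lemma orthogonal_of_different_degree:
  fixes P Q :: "real ^ 3 \<Rightarrow> real"
  assumes R: "R > 0"
    and P: "has_grad_lap P F (\<lambda>_. 0)" "\<And>x. x \<bullet> F x = real n * P x"
    and Q: "has_grad_lap Q G (\<lambda>_. 0)" "\<And>x. x \<bullet> G x = real n' * Q x"
    and f: "continuous_on UNIV f" and "n \<noteq> n'"
  shows "ball_integral R (\<lambda>x. f (x \<bullet> x) * (P x * Q x)) = 0"
proof -
  have grads: "has_gradient P F" "has_divergence F (\<lambda>_. 0)" "has_gradient Q G" "has_divergence G (\<lambda>_. 0)"
    using P(1) Q(1) by (auto simp: has_grad_lap_def)
  obtain w0 where w0: "\<And>t. (w0 has_vector_derivative f t) (at t)"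
    using einterval_antiderivative[of "-\<infinity>" \<infinity> f] f by (auto simp: continuous_on_eq_continuous_at)
  define w where "w = (\<lambda>t. w0 t - w0 (R\<^sup>2))"
  have w: "(w has_real_derivative f t) (at t)" for t
    using w0[of t] unfolding w_def
    by (auto intro!: derivative_eq_intros simp: has_real_derivative_iff_has_vector_derivative)
  let ?D = "\<lambda>x. P x *\<^sub>R G x - Q x *\<^sub>R F x"
  have "has_divergence ?D (\<lambda>x. (F x \<bullet> G x + P x * 0) - (G x \<bullet> F x + Q x * 0))"
    by (intro has_divergence_diff has_divergence_scale grads)
  then have D: "has_divergence ?D (\<lambda>_. 0)" by (simp add: inner_commute)
  have "has_divergence (\<lambda>x. w (x \<bullet> x) *\<^sub>R ?D x)
      (\<lambda>x. ((2 * f (x \<bullet> x)) *\<^sub>R x) \<bullet> ?D x + w (x \<bullet> x) * 0)"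
    using has_gradient_radial[OF w f] D by (rule has_divergence_scale)
  also have "(\<lambda>x. ((2 * f (x \<bullet> x)) *\<^sub>R x) \<bullet> ?D x + w (x \<bullet> x) * 0) =
      (\<lambda>x. 2 * (real n' - real n) * (f (x \<bullet> x) * (P x * Q x)))"
    by (simp add: fun_eq_iff inner_diff_right P(2) Q(2) algebra_simps)
  finally have "(LINT x|lborel. indicator (ball 0 R) x * (2 * (real n' - real n) * (f (x \<bullet> x) * (P x * Q x)))) = 0"
    by (rule divergence_theorem_tangential[OF R]) (simp add: w_def dot_square_norm)
  then show ?thesis
    using ball_integral_cmult[of R "2 * (real n' - real n)" "\<lambda>x. f (x \<bullet> x) * (P x * Q x)"] \<open>n \<noteq> n'\<close>
    by (simp add: ball_integral_def)
qed

lemma has_divergence_rot: "has_divergence rot (\<lambda>_. 0)"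
proof -
  have "linear rot" by (rule linearI) (simp_all add: rot_def vec_eq_iff forall_3)
  moreover have "(\<Sum>b\<in>Basis. rot b \<bullet> b) = 0" by (simp add: rot_position)
  ultimately show ?thesis using has_divergence_linear[of rot] by simp
qed

text \<open>For equal degrees let \<open>J(k, k')\<close> be the integral. Integrating the rotational derivative of
  \<open>f(|x|\<^sup>2) P Q\<close> gives \<open>k' J(k, - k') + k J(- k, k') = 0\<close>. Used for all signs this gives
  \<open>(k'\<^sup>2 - k\<^sup>2) J(k, k') = 0\<close>, and the remaining case \<open>k' = - k\<close> follows from the symmetry of \<open>J\<close>.\<close>

lemma orthogonal_of_different_order:
  assumes R: "R > 0"
    and kn: "\<bar>k\<bar> \<le> int n" "\<bar>k'\<bar> \<le> int n'" "(n, k) \<noteq> (n', k')"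
    and f: "\<And>t. (f has_field_derivative f' t) (at t)" "continuous_on UNIV f'"
  shows "ball_integral R (\<lambda>x. f (x \<bullet> x) * (solid_harmonic n k x * solid_harmonic n' k' x)) = 0"
proof -
  define J where "J = (\<lambda>l l'. ball_integral R (\<lambda>x. f (x \<bullet> x) * (solid_harmonic n l x * solid_harmonic n' l' x)))"
  have fc: "continuous_on UNIV f"
    using f(1) by (auto intro: continuous_at_imp_continuous_on DERIV_isCont)
  show ?thesis
  proof (cases "n = n'")
    case False
    show ?thesis
      by (rule orthogonal_of_different_degree[OF R solid_harmonic_laplace[OF kn(1)]
            solid_harmonic_euler[OF kn(1)] solid_harmonic_laplace[OF kn(2)]
            solid_harmonic_euler[OF kn(2)] fc False])
  next
    case True
    have rel: "of_int l' * J l (- l') + of_int l * J (- l) l' = 0"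
      if l: "\<bar>l\<bar> \<le> int n" "\<bar>l'\<bar> \<le> int n'" for l l'
    proof -
      let ?P = "solid_harmonic n l" and ?Q = "solid_harmonic n' l'"
      let ?P' = "solid_harmonic n (- l)" and ?Q' = "solid_harmonic n' (- l')"
      let ?F = "grad ?P" and ?G = "grad ?Q"
      have grads: "has_gradient ?P ?F" "has_gradient ?Q ?G"
        using solid_harmonic_laplace l by (simp_all add: has_grad_lap_def)
      have cont: "continuous_on UNIV (solid_harmonic p q)" if "\<bar>q\<bar> \<le> int p" for p q
        using solid_harmonic_laplace[OF that] unfolding has_grad_lap_def
        by (blast intro: has_gradient_continuous)
      have conts: "continuous_on UNIV ?P" "continuous_on UNIV ?Q" "continuous_on UNIV ?P'" "continuous_on UNIV ?Q'"
        using l by (auto intro: cont)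
      have fc': "continuous_on UNIV (\<lambda>x::real^3. f (x \<bullet> x))"
        by (rule continuous_on_compose2[OF fc]) (auto intro!: continuous_intros)
      let ?u = "\<lambda>x. f (x \<bullet> x) * (?P x * ?Q x)"
      let ?U = "\<lambda>x. f (x \<bullet> x) *\<^sub>R (?P x *\<^sub>R ?G x + ?Q x *\<^sub>R ?F x) + (?P x * ?Q x) *\<^sub>R ((2 * f' (x \<bullet> x)) *\<^sub>R x)"
      have "has_divergence (\<lambda>x. ?u x *\<^sub>R rot x) (\<lambda>x. ?U x \<bullet> rot x + ?u x * 0)"
        by (intro has_divergence_scale has_gradient_mult has_gradient_radial f grads has_divergence_rot)
      also have "(\<lambda>x. ?U x \<bullet> rot x + ?u x * 0) =
          (\<lambda>x. - of_int l' * (f (x \<bullet> x) * (?P x * ?Q' x)) + - of_int l * (f (x \<bullet> x) * (?P' x * ?Q x)))"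
        by (simp add: fun_eq_iff inner_add_left inner_commute[of _ "rot _"] solid_harmonic_rot l rot_position algebra_simps)
      finally have zero: "ball_integral R (\<lambda>x. - of_int l' * (f (x \<bullet> x) * (?P x * ?Q' x)) +
          - of_int l * (f (x \<bullet> x) * (?P' x * ?Q x))) = 0"
        unfolding ball_integral_def
        by (rule divergence_theorem_tangential[OF R])
           (simp add: inner_commute[of _ "rot _"] rot_position)
      have c: "continuous_on UNIV (\<lambda>x. - of_int l' * (f (x \<bullet> x) * (?P x * ?Q' x)))"
        "continuous_on UNIV (\<lambda>x. - of_int l * (f (x \<bullet> x) * (?P' x * ?Q x)))"
        by (intro continuous_intros conts fc')+
      have "ball_integral R (\<lambda>x. - of_int l' * (f (x \<bullet> x) * (?P x * ?Q' x))) +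
          ball_integral R (\<lambda>x. - of_int l * (f (x \<bullet> x) * (?P' x * ?Q x))) = 0"
        using zero ball_integral_add[OF c, of R] by (simp only:)
      then show ?thesis unfolding ball_integral_cmult J_def by simp
    qed
    have sym: "J l l' = J l' l" for l l'
      unfolding J_def True by (simp add: mult.commute)
    have "of_int k' * J k k' - of_int k * J (- k) (- k') = 0"
      using rel[of k "- k'"] kn by simp
    moreover have "of_int k' * J (- k) (- k') - of_int k * J k k' = 0"
      using rel[of "- k" k'] kn by simp
    ultimately have "(of_int k' * of_int k' - of_int k * of_int k) * J k k' = 0"
      by algebra
    then have "J k k' = 0 \<or> k' * k' = k * k"
      by (metis mult_eq_0_iff eq_iff_diff_eq_0 of_int_eq_iff of_int_mult)
    moreover have "J k k' = 0" if "k' * k' = k * k"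
    proof -
      have "k' = - k" "k \<noteq> 0"
        using that kn(3) True by (auto simp: square_eq_iff)
      then show ?thesis using \<open>of_int k' * J k k' - of_int k * J (- k) (- k') = 0\<close> sym[of k k']
        by simp
    qed
    ultimately show ?thesis unfolding J_def by blast
  qed
qed

text \<open>The divergence theorem for the field \<open>g \<nabla>h\<close>.\<close>

lemma green_tangential:
  assumes R: "R > 0" and g: "has_gradient g F"
    and h: "has_grad_lap h G (\<lambda>x. - l * h x)" and tangential: "\<And>x. norm x = R \<Longrightarrow> x \<bullet> G x = 0"
  shows "ball_integral R (\<lambda>x. F x \<bullet> G x) = l * ball_integral R (\<lambda>x. g x * h x)"
proof -
  have h': "has_gradient h G" "has_divergence G (\<lambda>x. - l * h x)" using h by (auto simp: has_grad_lap_def)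
  have cont: "continuous_on UNIV g" "continuous_on UNIV h" "continuous_on UNIV F" "continuous_on UNIV G"
    using g h' has_gradient_continuous by (auto simp: has_gradient_def)
  have "ball_integral R (\<lambda>x. F x \<bullet> G x + g x * (- l * h x)) = 0"
    unfolding ball_integral_def
    using has_divergence_scale[OF g h'(2)]
    by (rule divergence_theorem_tangential[OF R]) (simp add: tangential)
  moreover have "(\<lambda>x. g x * (- l * h x)) = (\<lambda>x. - l * (g x * h x))" by (simp add: fun_eq_iff)
  moreover have "continuous_on UNIV (\<lambda>x. F x \<bullet> G x)" "continuous_on UNIV (\<lambda>x. - l * (g x * h x))"
    by (intro continuous_intros cont)+
  ultimately have "ball_integral R (\<lambda>x. F x \<bullet> G x) + ball_integral R (\<lambda>x. - l * (g x * h x)) = 0"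
    using ball_integral_add by metis
  then show ?thesis unfolding ball_integral_cmult by simp
qed

section \<open>The modes and their gradients\<close>

text \<open>The factor \<open>psi n (b * r) / r ^ n\<close> as a function of \<open>t = r\<^sup>2\<close>, smooth also at \<open>t = 0\<close>.\<close>

definition mode_radial :: "nat \<Rightarrow> real \<Rightarrow> real \<Rightarrow> real" where
  "mode_radial n b t = (- 2 * b) ^ n * sinc_sqrt n (b\<^sup>2 * t)"

definition mode :: "nat \<Rightarrow> int \<Rightarrow> real \<Rightarrow> real ^ 3 \<Rightarrow> real" where
  "mode n k b x = mode_radial n b (x \<bullet> x) * solid_harmonic n k x"

lemma mode_spherical:
  assumes "\<bar>k\<bar> \<le> int n" "0 \<le> \<theta>" "\<theta> \<le> pi"
  shows "mode n k b (r *\<^sub>R e_r \<theta> \<phi>) = psi n (b * r) * sph_harm n k \<theta> \<phi>"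
proof -
  have "(- 2 * (b * r)) ^ n = (- 2 * b) ^ n * r ^ n"
    by (simp only: power_mult_distrib[symmetric] mult.assoc)
  then show ?thesis
    using solid_harmonic_spherical[OF assms, of r \<phi>]
    by (simp add: mode_def mode_radial_def psi_eq e_r_square power2_eq_square mult_ac)
qed

lemma g_fun_eq_mode:
  assumes "\<bar>k\<bar> \<le> int n"
  shows "g_fun R c (n, m, k) = (\<lambda>x. c (n, m, k) * mode n k (alpha n m / R) x)"
proof
  fix x
  have "mode n k (alpha n m / R) x =
      psi n (alpha n m / R * norm x) * sph_harm n k (polar_angle x) (azimuth x)"
    using mode_spherical[OF assms spherical_coordinates(2,3)[of x], where r = "norm x" and \<phi> = "azimuth x"]
    by (simp only: spherical_coordinates(1)[symmetric])
  then show "g_fun R c (n, m, k) x = c (n, m, k) * mode n k (alpha n m / R) x" by simp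
qed

lemma DERIV_mode_radial:
  "(mode_radial n b has_real_derivative (- 2 * b) ^ n * b\<^sup>2 * sinc_sqrt (Suc n) (b\<^sup>2 * t)) (at t)"
  unfolding mode_radial_def[abs_def]
  by (rule derivative_eq_intros DERIV_chain2[OF DERIV_sinc_sqrt] refl)+ simp

text \<open>With \<open>A\<close> the radial factor and \<open>t = |x|\<^sup>2\<close>, the Laplacian is \<open>P (4 t A'' + (4 n + 6) A')\<close>, where
  \<open>4 n\<close> comes from Euler's identity in the mixed term; the radial equation turns this into \<open>- b\<^sup>2 A P\<close>.
  The radial derivative \<open>x \<bullet> D x\<close> contains the factor \<open>z psi_deriv n z\<close> at \<open>z = b |x|\<close>.\<close>

lemma
  fixes b :: real
  assumes k: "\<bar>k\<bar> \<le> int n"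
  defines "D \<equiv> grad (mode n k b)"
  shows mode_helmholtz: "has_grad_lap (mode n k b) D (\<lambda>x. - b\<^sup>2 * mode n k b x)"
    and mode_neumann: "norm x = R \<Longrightarrow> b * R \<noteq> 0 \<Longrightarrow> psi_deriv n (b * R) = 0 \<Longrightarrow> x \<bullet> D x = 0"
proof -
  define P where "P = solid_harmonic n k"
  define K where "K = (- 2 * b) ^ n"
  \<comment> \<open>The \<open>i\<close>-th derivative of the radial factor.\<close>
  define A where "A = (\<lambda>i t. K * b ^ (2 * i) * sinc_sqrt (n + i) (b\<^sup>2 * t))"
  have A: "(A i has_real_derivative A (Suc i) t) (at t)" for i t
    unfolding A_def
    by (rule derivative_eq_intros DERIV_chain2[OF DERIV_sinc_sqrt] refl)+ (simp add: power2_eq_square)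
  have A_cont: "continuous_on UNIV (A i)" for i
    unfolding A_def by (intro continuous_intros)
  have ode: "4 * t * A 2 t + (4 * real n + 6) * A 1 t + b\<^sup>2 * A 0 t = 0" for t
  proof -
    have "4 * t * A 2 t + (4 * real n + 6) * A 1 t + b\<^sup>2 * A 0 t = K * b\<^sup>2 *
        (4 * (b\<^sup>2 * t) * sinc_sqrt (n + 2) (b\<^sup>2 * t) + (4 * real n + 6) * sinc_sqrt (n + 1) (b\<^sup>2 * t)
          + sinc_sqrt n (b\<^sup>2 * t))"
      by (simp add: A_def algebra_simps power2_eq_square numeral_eq_Suc)
    then show ?thesis unfolding sinc_sqrt_ode by simp
  qed
  have P: "has_grad_lap P (grad P) (\<lambda>_. 0)" "x \<bullet> grad P x = real n * P x" for x :: "real ^ 3"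
    unfolding P_def by (rule solid_harmonic_laplace solid_harmonic_euler k)+
  have mode: "mode n k b = (\<lambda>x. A 0 (x \<bullet> x) * P x)"
    by (simp add: fun_eq_iff mode_def mode_radial_def A_def K_def P_def)
  let ?G = "\<lambda>x. A 0 (x \<bullet> x) *\<^sub>R grad P x + P x *\<^sub>R (A 1 (x \<bullet> x) *\<^sub>R (2 *\<^sub>R x))"
  let ?l = "\<lambda>x::real^3. A 2 (x \<bullet> x) * ((2 *\<^sub>R x) \<bullet> (2 *\<^sub>R x)) + A 1 (x \<bullet> x) * (2 * real DIM(real^3))"
  have radial: "has_grad_lap (\<lambda>x::real^3. A 0 (x \<bullet> x)) (\<lambda>x. A 1 (x \<bullet> x) *\<^sub>R (2 *\<^sub>R x)) ?l"
    by (rule has_grad_lap_compose[OF has_grad_lap_square])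
       (use A[of 0] A[of 1] A_cont in \<open>simp_all add: numeral_2_eq_2\<close>)
  have lap: "has_grad_lap (mode n k b) ?G (\<lambda>x. - b\<^sup>2 * mode n k b x)"
  proof (rule has_grad_lap_cong[OF has_grad_lap_mult[OF radial P(1)]])
    fix x :: "real ^ 3"
    let ?t = "x \<bullet> x"
    have "A 0 ?t * 0 + 2 * ((A 1 ?t *\<^sub>R (2 *\<^sub>R x)) \<bullet> grad P x) + P x * ?l x =
        P x * (4 * ?t * A 2 ?t + (4 * real n + 6) * A 1 ?t)"
      by (simp add: P(2) algebra_simps)
    also have "4 * ?t * A 2 ?t + (4 * real n + 6) * A 1 ?t = - b\<^sup>2 * A 0 ?t"
      using ode[of ?t] by simp
    finally show "A 0 ?t * 0 + 2 * ((A 1 ?t *\<^sub>R (2 *\<^sub>R x)) \<bullet> grad P x) + P x * ?l x =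
        - b\<^sup>2 * mode n k b x"
      by (simp add: mode)
  qed (simp_all add: mode)
  then have D: "D = ?G" using has_gradient_imp_grad unfolding D_def has_grad_lap_def by blast
  show "has_grad_lap (mode n k b) D (\<lambda>x. - b\<^sup>2 * mode n k b x)" using lap by (simp only: D)
  show "x \<bullet> D x = 0" if x: "norm x = R" and z: "b * R \<noteq> 0" "psi_deriv n (b * R) = 0"
  proof -
    define z where "z = b * R"
    have xx: "b\<^sup>2 * (x \<bullet> x) = z\<^sup>2" using x by (simp add: z_def dot_square_norm power_mult_distrib)
    have "z * psi_deriv n z = (- 2 * z) ^ n * (real n * sinc_sqrt n (z\<^sup>2) + 2 * z\<^sup>2 * sinc_sqrt (Suc n) (z\<^sup>2))"
      by (cases n) (simp_all add: psi_deriv_def algebra_simps power2_eq_square)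
    then have "real n * sinc_sqrt n (z\<^sup>2) + 2 * z\<^sup>2 * sinc_sqrt (Suc n) (z\<^sup>2) = 0"
      using z by (simp add: z_def)
    moreover have "x \<bullet> D x = K * P x * (real n * sinc_sqrt n (z\<^sup>2) + 2 * z\<^sup>2 * sinc_sqrt (Suc n) (z\<^sup>2))"
      by (simp add: D inner_add_right P(2) A_def flip: xx) (simp add: algebra_simps)
    ultimately show ?thesis by simp
  qed
qed

lemma mode_orthogonal:
  assumes R: "R > 0" and kn: "\<bar>k\<bar> \<le> int n" "\<bar>k'\<bar> \<le> int n'" "(n, k) \<noteq> (n', k')"
  shows "ball_integral R (\<lambda>x. mode n k b x * mode n' k' b' x) = 0"
proof -
  let ?A = "mode_radial n b" and ?B = "mode_radial n' b'"
  let ?A' = "\<lambda>t. (- 2 * b) ^ n * b\<^sup>2 * sinc_sqrt (Suc n) (b\<^sup>2 * t)"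
  let ?B' = "\<lambda>t. (- 2 * b') ^ n' * b'\<^sup>2 * sinc_sqrt (Suc n') (b'\<^sup>2 * t)"
  have "ball_integral R (\<lambda>x. (?A (x \<bullet> x) * ?B (x \<bullet> x)) * (solid_harmonic n k x * solid_harmonic n' k' x)) = 0"
  proof (rule orthogonal_of_different_order[OF R kn, where f = "\<lambda>t. ?A t * ?B t"])
    show "((\<lambda>t. ?A t * ?B t) has_real_derivative ?A' t * ?B t + ?B' t * ?A t) (at t)" for t
      by (rule DERIV_mult DERIV_mode_radial)+
    show "continuous_on UNIV (\<lambda>t. ?A' t * ?B t + ?B' t * ?A t)"
      unfolding mode_radial_def by (intro continuous_intros)
  qed
  then show ?thesis by (simp add: mode_def mult_ac)
qed

text \<open>Near the origin the radial factor is close to its nonzero value there, so a direction in which the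
  spherical harmonic does not vanish suffices.\<close>

lemma mode_nonzero:
  assumes R: "R > 0" and k: "\<bar>k\<bar> \<le> int n" and "b \<noteq> 0"
  obtains x where "x \<in> ball 0 R" "mode n k b x \<noteq> 0"
proof -
  obtain \<theta> \<phi> where Y: "0 \<le> \<theta>" "\<theta> \<le> pi" "sph_harm n k \<theta> \<phi> \<noteq> 0"
    using sph_harm_nonzero[OF k] .
  have "((\<lambda>r. sinc_sqrt n ((b * r)\<^sup>2)) \<longlongrightarrow> sinc_sqrt n ((b * 0)\<^sup>2)) (at_right (0::real))"
    by (rule tendsto_within_subset[OF isContD], rule continuous_on_interior[of UNIV])
       (auto intro!: continuous_intros)
  then have "\<forall>\<^sub>F r in at_right 0. sinc_sqrt n ((b * r)\<^sup>2) \<noteq> 0"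
    using sinc_sqrt_at_0_nonzero[where 'a = real] by (intro tendsto_imp_eventually_ne) auto
  moreover have "\<forall>\<^sub>F r in at_right 0. r < R" "\<forall>\<^sub>F r in at_right (0::real). 0 < r"
    using R by (auto intro: eventually_at_right_less eventually_at_rightI[of 0 R])
  ultimately have "\<forall>\<^sub>F r in at_right 0. sinc_sqrt n ((b * r)\<^sup>2) \<noteq> 0 \<and> 0 < r \<and> r < R"
    by eventually_elim simp
  then obtain r where r: "sinc_sqrt n ((b * r)\<^sup>2) \<noteq> 0" "0 < r" "r < R"
    using eventually_happens'[OF trivial_limit_at_right_real] by blast
  show thesis
  proof (rule that)
    have "norm (e_r \<theta> \<phi>) = 1" using e_r_square[of \<theta> \<phi>] by (simp add: norm_eq_sqrt_inner)
    then show "r *\<^sub>R e_r \<theta> \<phi> \<in> ball 0 R" using r by simp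
    show "mode n k b (r *\<^sub>R e_r \<theta> \<phi>) \<noteq> 0"
      using mode_spherical[OF k Y(1,2)] r Y(3) \<open>b \<noteq> 0\<close> by (simp add: psi_eq)
  qed
qed

lemma has_divergence_eq_0:
  assumes "has_divergence F d" "open S" "x \<in> S" "\<And>y. y \<in> S \<Longrightarrow> F y = 0"
  shows "d x = 0"
proof -
  from assms(1) obtain D where D: "(F has_derivative D x) (at x)" "d x = (\<Sum>b\<in>Basis. D x b \<bullet> b)"
    unfolding has_divergence_def by blast
  have "(F has_derivative (\<lambda>_. 0)) (at x)"
    by (rule has_derivative_transform_within_open[OF has_derivative_const[of 0] assms(2,3)])
       (simp add: assms(4))
  then have "D x = (\<lambda>_. 0)" using D(1) has_derivative_unique by blast
  then show ?thesis by (simp add: D(2))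
qed

lemma DERIV_along_curve:
  assumes "GDERIV f (p t) :> G" "(p has_vector_derivative v) (at t)"
  shows "((\<lambda>s. f (p s)) has_real_derivative v \<bullet> G) (at t)"
  using has_derivative_compose[OF assms(2)[unfolded has_vector_derivative_def] assms(1)[unfolded gderiv_def]]
  by (simp add: has_field_derivative_def mult_commute_abs)

lemma e_r_axis:
  "e_r \<theta> \<phi> = (sin \<theta> * cos \<phi>) *\<^sub>R axis 1 1 + (sin \<theta> * sin \<phi>) *\<^sub>R axis 2 1 + cos \<theta> *\<^sub>R axis 3 1"
  by (simp add: e_r_def vec_eq_iff forall_3 axis_def)

lemma has_vector_derivative_e_r:
  "((\<lambda>\<theta>. r *\<^sub>R e_r \<theta> \<phi>) has_vector_derivative r *\<^sub>R e_theta \<theta> \<phi>) (at \<theta>)"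
  "((\<lambda>\<phi>. r *\<^sub>R e_r \<theta> \<phi>) has_vector_derivative (r * sin \<theta>) *\<^sub>R e_phi \<theta> \<phi>) (at \<phi>)"
proof -
  have "((\<lambda>\<theta>. r *\<^sub>R e_r \<theta> \<phi>) has_vector_derivative r *\<^sub>R
      ((cos \<theta> * cos \<phi>) *\<^sub>R axis 1 1 + (cos \<theta> * sin \<phi>) *\<^sub>R axis 2 1 + (- sin \<theta>) *\<^sub>R axis 3 1)) (at \<theta>)"
    unfolding e_r_axis by (auto intro!: derivative_eq_intros simp: scaleR_add_right scaleR_diff_right mult_ac)
  then show "((\<lambda>\<theta>. r *\<^sub>R e_r \<theta> \<phi>) has_vector_derivative r *\<^sub>R e_theta \<theta> \<phi>) (at \<theta>)"
    by (rule has_vector_derivative_eq_rhs) (simp add: e_theta_def vec_eq_iff forall_3 axis_def)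
  have "((\<lambda>\<phi>. r *\<^sub>R e_r \<theta> \<phi>) has_vector_derivative r *\<^sub>R
      ((sin \<theta> * - sin \<phi>) *\<^sub>R axis 1 1 + (sin \<theta> * cos \<phi>) *\<^sub>R axis 2 1)) (at \<phi>)"
    unfolding e_r_axis by (auto intro!: derivative_eq_intros simp: scaleR_add_right scaleR_diff_right mult_ac)
  then show "((\<lambda>\<phi>. r *\<^sub>R e_r \<theta> \<phi>) has_vector_derivative (r * sin \<theta>) *\<^sub>R e_phi \<theta> \<phi>) (at \<phi>)"
    by (rule has_vector_derivative_eq_rhs) (simp add: e_phi_def vec_eq_iff forall_3 axis_def)
qed

text \<open>Each component is the derivative of \<open>psi n (b * r) * sph_harm n k \<theta> \<phi>\<close> along a coordinate curve, whose
  velocity is \<open>e_r\<close>, \<open>r e_theta\<close> or \<open>r sin \<theta> e_phi\<close>. That the harmonic is differentiable in the angles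
  follows from its Cartesian form on the unit sphere.\<close>

lemma mode_gradient_components:
  fixes b r \<theta> \<phi> :: real
  assumes k: "\<bar>k\<bar> \<le> int n" and r: "r > 0" and \<theta>: "0 < \<theta>" "\<theta> < pi"
  defines "q \<equiv> grad (mode n k b) (r *\<^sub>R e_r \<theta> \<phi>)"
  shows "q \<bullet> e_r \<theta> \<phi> = b * deriv (psi n) (b * r) * sph_harm n k \<theta> \<phi>"
    and "q \<bullet> e_theta \<theta> \<phi> = 1 / r * psi n (b * r) * deriv (\<lambda>t. sph_harm n k t \<phi>) \<theta>"
    and "q \<bullet> e_phi \<theta> \<phi> = 1 / r * psi n (b * r) * (1 / sin \<theta> * deriv (\<lambda>p. sph_harm n k \<theta> p) \<phi>)"
proof -
  have q: "GDERIV (mode n k b) (r *\<^sub>R e_r \<theta> \<phi>) :> q"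
    using mode_helmholtz[OF k] by (simp add: q_def has_grad_lap_def has_gradient_def)
  have P: "GDERIV (solid_harmonic n k) x :> grad (solid_harmonic n k) x" for x
    using solid_harmonic_laplace[OF k] by (simp add: has_grad_lap_def has_gradient_def)
  have Y: "sph_harm n k t p = solid_harmonic n k (1 *\<^sub>R e_r t p)" if "0 < t" "t < pi" for t p
    using solid_harmonic_spherical[OF k, of t 1 p] that by simp
  have ev: "\<forall>\<^sub>F t in nhds \<theta>. 0 < t \<and> t < pi"
    using eventually_nhds_in_open[of "{0<..<pi}" \<theta>] \<theta> by (auto elim!: eventually_mono)
  have "((\<lambda>s. s *\<^sub>R e_r \<theta> \<phi>) has_vector_derivative e_r \<theta> \<phi>) (at r)"
    by (auto intro!: derivative_eq_intros)
  from DERIV_along_curve[OF q this]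
  have "((\<lambda>s. psi n (b * s) * sph_harm n k \<theta> \<phi>) has_real_derivative e_r \<theta> \<phi> \<bullet> q) (at r)"
    using mode_spherical[OF k] \<theta> by simp
  moreover have "((\<lambda>s. psi n (b * s) * sph_harm n k \<theta> \<phi>) has_real_derivative
      psi_deriv n (b * r) * b * sph_harm n k \<theta> \<phi>) (at r)"
    by (rule derivative_eq_intros DERIV_chain2[OF DERIV_psi] refl)+ simp
  ultimately have "e_r \<theta> \<phi> \<bullet> q = psi_deriv n (b * r) * b * sph_harm n k \<theta> \<phi>"
    by (rule DERIV_unique)
  then show "q \<bullet> e_r \<theta> \<phi> = b * deriv (psi n) (b * r) * sph_harm n k \<theta> \<phi>"
    by (simp add: inner_commute deriv_psi)

  have "\<forall>\<^sub>F t in nhds \<theta>. sph_harm n k t \<phi> = solid_harmonic n k (1 *\<^sub>R e_r t \<phi>)"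
    using ev by eventually_elim (simp add: Y del: scaleR_one)
  then have "((\<lambda>t. sph_harm n k t \<phi>) has_real_derivative
      (1 *\<^sub>R e_theta \<theta> \<phi>) \<bullet> grad (solid_harmonic n k) (1 *\<^sub>R e_r \<theta> \<phi>)) (at \<theta>)"
    using DERIV_along_curve[OF P has_vector_derivative_e_r(1)]
    by (subst DERIV_cong_ev[OF refl _ refl])
  then have dY: "((\<lambda>t. sph_harm n k t \<phi>) has_real_derivative deriv (\<lambda>t. sph_harm n k t \<phi>) \<theta>) (at \<theta>)"
    by (metis DERIV_imp_deriv)
  have "\<forall>\<^sub>F t in nhds \<theta>. psi n (b * r) * sph_harm n k t \<phi> = mode n k b (r *\<^sub>R e_r t \<phi>)"
    using ev by eventually_elim (simp add: mode_spherical[OF k])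
  then have "((\<lambda>t. psi n (b * r) * sph_harm n k t \<phi>) has_real_derivative (r *\<^sub>R e_theta \<theta> \<phi>) \<bullet> q) (at \<theta>)"
    using DERIV_along_curve[OF q has_vector_derivative_e_r(1)]
    by (subst DERIV_cong_ev[OF refl _ refl])
  then have "(r *\<^sub>R e_theta \<theta> \<phi>) \<bullet> q = psi n (b * r) * deriv (\<lambda>t. sph_harm n k t \<phi>) \<theta>"
    using DERIV_cmult[OF dY] by (rule DERIV_unique)
  then show "q \<bullet> e_theta \<theta> \<phi> = 1 / r * psi n (b * r) * deriv (\<lambda>t. sph_harm n k t \<phi>) \<theta>"
    using r by (simp add: inner_commute field_simps)

  have "((\<lambda>p. sph_harm n k \<theta> p) has_real_derivative
      ((1 * sin \<theta>) *\<^sub>R e_phi \<theta> \<phi>) \<bullet> grad (solid_harmonic n k) (1 *\<^sub>R e_r \<theta> \<phi>)) (at \<phi>)"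
    using DERIV_along_curve[OF P has_vector_derivative_e_r(2)[of 1 \<theta> \<phi>]]
    by (simp add: Y \<theta> del: scaleR_one)
  then have dY: "((\<lambda>p. sph_harm n k \<theta> p) has_real_derivative deriv (\<lambda>p. sph_harm n k \<theta> p) \<phi>) (at \<phi>)"
    by (metis DERIV_imp_deriv)
  have "((\<lambda>p. psi n (b * r) * sph_harm n k \<theta> p) has_real_derivative ((r * sin \<theta>) *\<^sub>R e_phi \<theta> \<phi>) \<bullet> q) (at \<phi>)"
    using DERIV_along_curve[OF q has_vector_derivative_e_r(2)] \<theta>
    by (simp add: mode_spherical[OF k])
  then have "((r * sin \<theta>) *\<^sub>R e_phi \<theta> \<phi>) \<bullet> q = psi n (b * r) * deriv (\<lambda>p. sph_harm n k \<theta> p) \<phi>"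
    using DERIV_cmult[OF dY] by (rule DERIV_unique)
  moreover have "sin \<theta> > 0" using \<theta> by (rule sin_gt_zero)
  ultimately show "q \<bullet> e_phi \<theta> \<phi> = 1 / r * psi n (b * r) * (1 / sin \<theta> * deriv (\<lambda>p. sph_harm n k \<theta> p) \<phi>)"
    using r by (simp add: inner_commute field_simps)
qed

lemma
  assumes R: "R > 0" and \<kappa>: "(n, m, k) \<in> kappas"
  defines "b \<equiv> alpha n m / R"
  shows q_field_eq: "q_field R c (n, m, k) = (\<lambda>x. c (n, m, k) *\<^sub>R grad (mode n k b) x)"
    and g_fun_helmholtz: "has_grad_lap (g_fun R c (n, m, k)) (q_field R c (n, m, k))
      (\<lambda>x. - b\<^sup>2 * g_fun R c (n, m, k) x)"
    and q_field_tangential: "norm x = R \<Longrightarrow> x \<bullet> q_field R c (n, m, k) x = 0"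
proof -
  have k: "\<bar>k\<bar> \<le> int n" and m: "m \<ge> 1" using \<kappa> by (auto simp: kappas_def)
  let ?c = "c (n, m, k)"
  have g: "g_fun R c (n, m, k) = (\<lambda>x. ?c * mode n k b x)"
    unfolding b_def using k by (rule g_fun_eq_mode)
  have lap: "has_grad_lap (\<lambda>x. ?c * mode n k b x) (\<lambda>x. ?c *\<^sub>R grad (mode n k b) x)
      (\<lambda>x. ?c * (- b\<^sup>2 * mode n k b x))"
    by (rule has_grad_lap_cmult[OF mode_helmholtz[OF k]])
  then have "has_gradient (\<lambda>x. ?c * mode n k b x) (\<lambda>x. ?c *\<^sub>R grad (mode n k b) x)"
    by (simp add: has_grad_lap_def)
  from has_gradient_imp_grad[OF this]
  show q: "q_field R c (n, m, k) = (\<lambda>x. ?c *\<^sub>R grad (mode n k b) x)"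
    unfolding q_field_def g by (rule ext)
  show "has_grad_lap (g_fun R c (n, m, k)) (q_field R c (n, m, k))
      (\<lambda>x. - b\<^sup>2 * g_fun R c (n, m, k) x)"
    using lap by (simp add: g q mult.left_commute)
  have "b * R = alpha n m" using R by (simp add: b_def)
  then show "x \<bullet> q_field R c (n, m, k) x = 0" if "norm x = R"
    using mode_neumann[OF k that, of b] alpha_pos[OF m, of n] psi_deriv_alpha[OF m, of n]
    by (simp add: q)
qed

text \<open>If the field vanished in the ball, so would its divergence \<open>- b\<^sup>2 g\<close>, but \<open>g\<close> is not zero there.\<close>

lemma q_field_solves:
  assumes R: "R > 0" and \<kappa>: "(n, m, k) \<in> kappas" and c: "c (n, m, k) \<noteq> 0"
  shows "solves_grad_div_problem R ((alpha n m)\<^sup>2 / R\<^sup>2) (q_field R c (n, m, k))"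
proof -
  have k: "\<bar>k\<bar> \<le> int n" and m: "m \<ge> 1" using \<kappa> by (auto simp: kappas_def)
  define b where "b = alpha n m / R"
  define g q where "g = g_fun R c (n, m, k)" and "q = q_field R c (n, m, k)"
  have b: "b \<noteq> 0" using alpha_pos[OF m, of n] R by (simp add: b_def)
  have lap: "has_grad_lap g q (\<lambda>x. - b\<^sup>2 * g x)"
    unfolding g_def q_def b_def using R \<kappa> by (rule g_fun_helmholtz)
  then have gq: "has_gradient g q" and qd: "has_divergence q (\<lambda>x. - b\<^sup>2 * g x)"
    by (simp_all add: has_grad_lap_def)
  have q_cont: "continuous_on UNIV q" using qd by (rule has_divergence_continuous)
  have div: "divergence q = (\<lambda>x. - b\<^sup>2 * g x)"
    using has_divergence_imp_divergence(2)[OF qd] by (simp add: fun_eq_iff)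
  have grad_div: "has_gradient (divergence q) (\<lambda>x. (- b\<^sup>2) *\<^sub>R q x)"
    unfolding div by (rule has_gradient_cmult[OF gq])
  then have "divergence q differentiable (at x)" for x
    by (auto simp: has_gradient_def gderiv_def intro: differentiableI)
  moreover have "- grad (divergence q) x = ((alpha n m)\<^sup>2 / R\<^sup>2) *\<^sub>R q x" for x
    by (simp add: has_gradient_imp_grad[OF grad_div] b_def power_divide)
  moreover have "\<exists>x\<in>ball 0 R. q x \<noteq> 0"
  proof (rule ccontr)
    assume "\<not> ?thesis"
    then have "- b\<^sup>2 * g x = 0" if "x \<in> ball 0 R" for x
      using has_divergence_eq_0[OF qd open_ball that] by blast
    moreover obtain x where "x \<in> ball 0 R" "mode n k b x \<noteq> 0"
      using mode_nonzero[OF R k b] .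
    ultimately show False
      using b c by (auto simp: g_def g_fun_eq_mode[OF k] simp flip: b_def)
  qed
  moreover have "(x /\<^sub>R R) \<bullet> q x = 0" if "x \<in> sphere 0 R" for x
    using q_field_tangential[OF R \<kappa>, of x c] that by (simp add: q_def)
  ultimately show ?thesis
    unfolding solves_grad_div_problem_def q_def[symmetric]
    using continuous_imp_L2[OF q_cont] has_divergence_imp_divergence(1)[OF qd]
      continuous_on_subset[OF q_cont] by auto
qed

text \<open>Green's identity in both orders gives \<open>b\<^sup>2 I = b'\<^sup>2 I\<close> for the integral \<open>I\<close> of \<open>g g'\<close>. If the pairs
  \<open>(n, k)\<close> differ, \<open>I = 0\<close> by the orthogonality of the modes; if they agree, the numbers \<open>\<alpha>\<^sub>n\<^sub>,\<^sub>m\<close> differ and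
  so do \<open>b\<^sup>2\<close> and \<open>b'\<^sup>2\<close>.\<close>

lemma q_field_orthogonal:
  assumes R: "R > 0" and \<kappa>: "\<kappa> \<in> kappas" "\<kappa>' \<in> kappas" "\<kappa>' \<noteq> \<kappa>"
  shows "L2_inner (ball 0 R) (q_field R c \<kappa>) (q_field R c \<kappa>') = 0"
proof -
  obtain n m k where kap: "\<kappa> = (n, m, k)" by (cases \<kappa>)
  obtain n' m' k' where kap': "\<kappa>' = (n', m', k')" by (cases \<kappa>')
  have k: "\<bar>k\<bar> \<le> int n" "m \<ge> 1" and k': "\<bar>k'\<bar> \<le> int n'" "m' \<ge> 1"
    using \<kappa> by (auto simp: kappas_def kap kap')
  define b b' where "b = alpha n m / R" and "b' = alpha n' m' / R"
  define g q where "g = g_fun R c \<kappa>" and "q = q_field R c \<kappa>"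
  define g' q' where "g' = g_fun R c \<kappa>'" and "q' = q_field R c \<kappa>'"
  have lap: "has_grad_lap g q (\<lambda>x. - b\<^sup>2 * g x)"
    unfolding g_def q_def b_def kap by (rule g_fun_helmholtz[OF R \<kappa>(1)[unfolded kap]])
  have lap': "has_grad_lap g' q' (\<lambda>x. - b'\<^sup>2 * g' x)"
    unfolding g'_def q'_def b'_def kap' by (rule g_fun_helmholtz[OF R \<kappa>(2)[unfolded kap']])
  note grad = conjunct1[OF lap[unfolded has_grad_lap_def]] conjunct1[OF lap'[unfolded has_grad_lap_def]]
  have tang: "x \<bullet> q x = 0" "x \<bullet> q' x = 0" if "norm x = R" for x
    unfolding q_def q'_def kap kap'
    using q_field_tangential[OF R \<kappa>(1)[unfolded kap] that] q_field_tangential[OF R \<kappa>(2)[unfolded kap'] that]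
    by simp_all
  define I where "I = ball_integral R (\<lambda>x. g x * g' x)"
  have I': "ball_integral R (\<lambda>x. q x \<bullet> q' x) = b'\<^sup>2 * I"
    unfolding I_def by (rule green_tangential[OF R grad(1) lap' tang(2)])
  have "ball_integral R (\<lambda>x. q' x \<bullet> q x) = b\<^sup>2 * ball_integral R (\<lambda>x. g' x * g x)"
    by (rule green_tangential[OF R grad(2) lap tang(1)])
  then have "b\<^sup>2 * I = b'\<^sup>2 * I" using I' by (simp add: I_def inner_commute mult.commute)
  moreover have "I = 0" if "(n, k) \<noteq> (n', k')"
  proof -
    have "ball_integral R (\<lambda>x. (c \<kappa> * c \<kappa>') * (mode n k b x * mode n' k' b' x)) = 0"
      unfolding ball_integral_cmult using mode_orthogonal[OF R k(1) k'(1) that] by simp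
    moreover have "g x * g' x = (c \<kappa> * c \<kappa>') * (mode n k b x * mode n' k' b' x)" for x
      unfolding g_def g'_def kap kap' g_fun_eq_mode[OF k(1)] g_fun_eq_mode[OF k'(1)] b_def b'_def
      by simp
    ultimately show ?thesis by (simp only: I_def)
  qed
  moreover have "b\<^sup>2 \<noteq> b'\<^sup>2" if "(n, k) = (n', k')"
  proof -
    have "m \<noteq> m'" using \<kappa>(3) that by (auto simp: kap kap')
    then have "alpha n m \<noteq> alpha n m'"
      using strict_mono_eq[OF alpha_strict_mono] by blast
    then show ?thesis
      using that R alpha_pos[OF k(2), of n] alpha_pos[OF k'(2), of n]
      by (simp add: b_def b'_def power_divide power2_eq_iff_nonneg)
  qed
  ultimately have "I = 0" by auto
  moreover have "continuous_on UNIV q" "continuous_on UNIV q'"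
    using grad by (simp_all add: has_gradient_def)
  ultimately show ?thesis
    using I' by (simp add: L2_inner_eq_ball_integral flip: q_def q'_def)
qed

theorem mainTheorem5:
  fixes R :: real and c :: "nat \<times> nat \<times> int \<Rightarrow> real"
  assumes "R > 0"
    and "\<And>\<kappa>. \<kappa> \<in> kappas \<Longrightarrow> c \<kappa> \<noteq> 0"
  shows "(\<forall>(n, m, k) \<in> kappas.
            (\<forall>x\<in>cball 0 R. GDERIV (g_fun R c (n, m, k)) x :> q_field R c (n, m, k) x) \<and>
            solves_grad_div_problem R ((alpha n m)\<^sup>2 / R\<^sup>2) (q_field R c (n, m, k)) \<and>
            (\<forall>r \<theta> \<phi>. 0 < r \<and> r < R \<and> 0 < \<theta> \<and> \<theta> < pi \<longrightarrow>
               (let q = q_field R c (n, m, k) (r *\<^sub>R e_r \<theta> \<phi>);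
                    q_r = q \<bullet> e_r \<theta> \<phi>; q_theta = q \<bullet> e_theta \<theta> \<phi>; q_phi = q \<bullet> e_phi \<theta> \<phi>
                in q_r = c (n, m, k) * (alpha n m / R) *
                         deriv (psi n) (alpha n m * r / R) * sph_harm n k \<theta> \<phi> \<and>
                   complex_of_real q_phi + \<i> * complex_of_real q_theta =
                     complex_of_real (c (n, m, k) * (1 / r) * psi n (alpha n m * r / R)) *
                     H_op (sph_harm n k) \<theta> \<phi>))) \<and>
         (\<forall>\<kappa>\<in>kappas. \<forall>\<kappa>'\<in>kappas. \<kappa>' \<noteq> \<kappa> \<longrightarrow>
            L2_inner (ball 0 R) (q_field R c \<kappa>) (q_field R c \<kappa>') = 0) \<and>
         (\<forall>(n, m, k) \<in> kappas.
            g_fun R c (n, m, k) \<in> L2 (ball 0 R) \<and>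
            L2_norm (ball 0 R) (q_field R c (n, m, k)) =
              (alpha n m / R) * L2_norm (ball 0 R) (g_fun R c (n, m, k)))"
proof (intro conjI ballI impI)
  fix \<kappa> :: "nat \<times> nat \<times> int" assume \<kappa>: "\<kappa> \<in> kappas"
  obtain n m k where kap: "\<kappa> = (n, m, k)" by (cases \<kappa>)
  have kap_in: "(n, m, k) \<in> kappas" and k: "\<bar>k\<bar> \<le> int n" and m: "m \<ge> 1"
    using \<kappa> by (auto simp: kap kappas_def)
  define b where "b = alpha n m / R"
  let ?g = "g_fun R c (n, m, k)" and ?q = "q_field R c (n, m, k)" and ?c = "c (n, m, k)"
  have b: "b > 0" using alpha_pos[OF m, of n] assms(1) by (simp add: b_def)
  have lap: "has_grad_lap ?g ?q (\<lambda>x. - b\<^sup>2 * ?g x)"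
    unfolding b_def by (rule g_fun_helmholtz[OF assms(1) kap_in])
  then have grad: "has_gradient ?g ?q" by (simp add: has_grad_lap_def)
  then have g_cont: "continuous_on UNIV ?g" and q_cont: "continuous_on UNIV ?q"
    by (rule has_gradient_continuous) (use grad in \<open>simp add: has_gradient_def\<close>)
  have q: "?q x = ?c *\<^sub>R grad (mode n k b) x" for x
    unfolding b_def q_field_eq[OF assms(1) kap_in] ..

  have comp: "let q = ?q (r *\<^sub>R e_r \<theta> \<phi>);
        q_r = q \<bullet> e_r \<theta> \<phi>; q_theta = q \<bullet> e_theta \<theta> \<phi>; q_phi = q \<bullet> e_phi \<theta> \<phi>
      in q_r = ?c * (alpha n m / R) * deriv (psi n) (alpha n m * r / R) * sph_harm n k \<theta> \<phi> \<and>
         complex_of_real q_phi + \<i> * complex_of_real q_theta =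
           complex_of_real (?c * (1 / r) * psi n (alpha n m * r / R)) * H_op (sph_harm n k) \<theta> \<phi>"
    if r: "0 < r" "0 < \<theta>" "\<theta> < pi" for r \<theta> \<phi>
  proof -
    have b_r: "alpha n m * r / R = b * r" by (simp add: b_def)
    show ?thesis
      unfolding Let_def q inner_scaleR_left mode_gradient_components[OF k r] b_def[symmetric] b_r H_op_def
      by (simp add: complex_eq_iff mult_ac)
  qed
  show "case \<kappa> of (n, m, k) \<Rightarrow>
      (\<forall>x\<in>cball 0 R. GDERIV (g_fun R c (n, m, k)) x :> q_field R c (n, m, k) x) \<and>
      solves_grad_div_problem R ((alpha n m)\<^sup>2 / R\<^sup>2) (q_field R c (n, m, k)) \<and>
      (\<forall>r \<theta> \<phi>. 0 < r \<and> r < R \<and> 0 < \<theta> \<and> \<theta> < pi \<longrightarrow>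
         (let q = q_field R c (n, m, k) (r *\<^sub>R e_r \<theta> \<phi>);
              q_r = q \<bullet> e_r \<theta> \<phi>; q_theta = q \<bullet> e_theta \<theta> \<phi>; q_phi = q \<bullet> e_phi \<theta> \<phi>
          in q_r = c (n, m, k) * (alpha n m / R) *
                   deriv (psi n) (alpha n m * r / R) * sph_harm n k \<theta> \<phi> \<and>
             complex_of_real q_phi + \<i> * complex_of_real q_theta =
               complex_of_real (c (n, m, k) * (1 / r) * psi n (alpha n m * r / R)) *
               H_op (sph_harm n k) \<theta> \<phi>))"
    unfolding kap prod.case
  proof (intro conjI allI impI ballI)
    show "GDERIV ?g x :> ?q x" for x using grad by (simp add: has_gradient_def)
    show "solves_grad_div_problem R ((alpha n m)\<^sup>2 / R\<^sup>2) ?q"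
      using assms(1) kap_in assms(2)[OF kap_in] by (rule q_field_solves)
  qed (rule comp; blast)

  have "ball_integral R (\<lambda>x. ?q x \<bullet> ?q x) = b\<^sup>2 * ball_integral R (\<lambda>x. ?g x * ?g x)"
    using green_tangential[OF assms(1) grad lap] q_field_tangential[OF assms(1) kap_in] by blast
  then have "L2_norm (ball 0 R) ?q = b * L2_norm (ball 0 R) ?g"
    using b by (simp only: L2_norm_def L2_inner_eq_ball_integral[OF q_cont q_cont]
        L2_inner_eq_ball_integral[OF g_cont g_cont] inner_real_def real_sqrt_mult real_sqrt_abs abs_of_pos)
  then show "case \<kappa> of (n, m, k) \<Rightarrow> g_fun R c (n, m, k) \<in> L2 (ball 0 R) \<and>
      L2_norm (ball 0 R) (q_field R c (n, m, k)) =
        (alpha n m / R) * L2_norm (ball 0 R) (g_fun R c (n, m, k))"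
    unfolding kap prod.case b_def using continuous_imp_L2[OF g_cont] by blast
next
  fix \<kappa> \<kappa>' :: "nat \<times> nat \<times> int" assume "\<kappa> \<in> kappas" "\<kappa>' \<in> kappas" "\<kappa>' \<noteq> \<kappa>"
  then show "L2_inner (ball 0 R) (q_field R c \<kappa>) (q_field R c \<kappa>') = 0"
    by (rule q_field_orthogonal[OF assms(1)])
qed

end
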